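(* Let $I=[0,1]$, let $f\colon I\to I$ be a piecewise monotone, post-critically finite, locally eventually onto map, and let $x\in X_f:=\varprojlim(I,f)$. Then there exists a thin planar embedding $\nu_x\colon X_f\to\mathbb{R}^2$ such that $\nu_x(x)$ is an accessible point of $\nu_x(X_f)$.
   Context: $\mathbb{N}=\{1,2,\dots\}$; "map" means continuous function; $f^n$ is the $n$-th iterate of $f$, with $f^0=\mathrm{id}$. A map $f\colon I\to I$ is piecewise monotone if there are $m\ge 0$ and points $0=c_0<c_1<\dots<c_m<c_{m+1}=1$ such that $f$ is strictly monotone on each $[c_i,c_{i+1}]$, $0\le i\le m$; here $c_1,\dots,c_m$ are taken to be exactly the turning points of $f$ (interior points at which $f$ changes from increasing to decreasing or vice versa). The critical set is $\{c_0,c_1,\dots,c_m,c_{m+1}\}$ (the endpoints $0,1$ are included). A piecewise monotone map $f$ is post-critically finite if for every $i\in\{0,\dots,m+1\}$ there are $j(i)\in\mathbb{N}$ and $k(i)\ge 0$ such that $f^{j(i)+k(i)}(c_i)=f^{k(i)}(c_i)$. An onto map $f\colon I\to I$ is locally eventually onto (leo) if for every nondegenerate interval $J\subset I$ there is $n\in\mathbb{N}$ with $f^n(J)=I$. The inverse limit is $\varprojlim(I,f)=\{(\xi_0,\xi_1,\xi_2,\ldots)\in I^{\infty}: f(\xi_i)=\xi_{i-1}\text{ for all } i\in\mathbb{N}\}$, with the topology inherited from the product topology on $I^\infty$. A planar embedding of a continuum $X$ is a map $\nu\colon X\to\mathbb{R}^2$ that is a homeomorphism onto its image $\nu(X)$.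 It is called thin if for every $\varepsilon>0$ there is a finite collection $\ell_1,\ldots,\ell_n$ of nonempty open connected subsets of $\mathbb{R}^2$, each of diameter less than $\varepsilon$, such that $\ell_i\cap\ell_j\neq\emptyset$ if and only if $|i-j|\le 1$, and $\nu(X)\subset\bigcup_{i=1}^n\ell_i$. For a continuum $Y\subset\mathbb{R}^2$, a point $\xi\in Y$ is accessible if there is an arc $A\subset\mathbb{R}^2$ (a homeomorphic copy of $[0,1]$) with $A\cap Y=\{\xi\}$. *)

theory Defs
  imports "HOL-Analysis.Analysis"
begin

text \<open>
  A self-map of the unit interval is a function on the reals of which only the restriction to
  \<open>{0..1}\<close> matters; every definition below looks only at that restriction, provided
  \<open>f\<close> maps \<open>{0..1}\<close> into itself.
\<close>

definition turning_points :: "(real \<Rightarrow> real) \<Rightarrow> real set" where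
  "turning_points f =
     {t. \<exists>a b. 0 \<le> a \<and> a < t \<and> t < b \<and> b \<le> 1 \<and>
        (strict_mono_on {a..t} f \<and> strict_antimono_on {t..b} f \<or>
         strict_antimono_on {a..t} f \<and> strict_mono_on {t..b} f)}"

text \<open>
  The last conjunct is the convention that the interior partition points are exactly the turning
  points. It excludes no map: points of a partition that are not turning points can be deleted.
\<close>

definition piecewise_monotone :: "(real \<Rightarrow> real) \<Rightarrow> bool" where
  "piecewise_monotone f \<longleftrightarrow>
     (\<exists>m (c :: nat \<Rightarrow> real).
        c 0 = 0 \<and> c (Suc m) = 1 \<and> (\<forall>i\<le>m. c i < c (Suc i)) \<and>
        (\<forall>i\<le>m. strict_mono_on {c i..c (Suc i)} f \<or> strict_antimono_on {c i..c (Suc i)} f) \<and>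
        c ` {1..m} = turning_points f)"

definition critical_set :: "(real \<Rightarrow> real) \<Rightarrow> real set" where
  "critical_set f = {0, 1} \<union> turning_points f"

definition post_critically_finite :: "(real \<Rightarrow> real) \<Rightarrow> bool" where
  "post_critically_finite f \<longleftrightarrow>
     (\<forall>c\<in>critical_set f. \<exists>j k. 1 \<le> j \<and> (f ^^ (j + k)) c = (f ^^ k) c)"

definition locally_eventually_onto :: "(real \<Rightarrow> real) \<Rightarrow> bool" where
  "locally_eventually_onto f \<longleftrightarrow>
     f ` {0..1} = {0..1} \<and>
     (\<forall>J. is_interval J \<and> J \<subseteq> {0..1} \<and> (\<exists>a\<in>J. \<exists>b\<in>J. a < b) \<longrightarrow>
        (\<exists>n\<ge>1. (f ^^ n) ` J = {0..1}))"

text \<open>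
  The library topology on \<open>nat \<Rightarrow> real\<close> is the product topology, so the
  inverse limit, as a subset of this type, carries the topology inherited from the product.
\<close>

definition inverse_limit :: "(real \<Rightarrow> real) \<Rightarrow> (nat \<Rightarrow> real) set" where
  "inverse_limit f = {\<xi>. (\<forall>i. \<xi> i \<in> {0..1}) \<and> (\<forall>i\<ge>1. f (\<xi> i) = \<xi> (i - 1))}"

definition planar_embedding :: "'a::topological_space set \<Rightarrow> ('a \<Rightarrow> real ^ 2) \<Rightarrow> bool" where
  "planar_embedding X \<nu> \<longleftrightarrow> (\<exists>g. homeomorphism X (\<nu> ` X) \<nu> g)"

text \<open>
  Boundedness is required explicitly because \<open>diameter\<close> is a real number and has no
  meaningful value on unbounded sets.
\<close>

definition thin_planar_embedding :: "'a::topological_space set \<Rightarrow> ('a \<Rightarrow> real ^ 2) \<Rightarrow> bool" where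
  "thin_planar_embedding X \<nu> \<longleftrightarrow>
     planar_embedding X \<nu> \<and>
     (\<forall>\<epsilon>>0. \<exists>n (l :: nat \<Rightarrow> (real ^ 2) set).
        (\<forall>i\<in>{1..n}. l i \<noteq> {} \<and> open (l i) \<and> connected (l i) \<and>
           bounded (l i) \<and> diameter (l i) < \<epsilon>) \<and>
        (\<forall>i\<in>{1..n}. \<forall>j\<in>{1..n}. l i \<inter> l j \<noteq> {} \<longleftrightarrow> \<bar>int i - int j\<bar> \<le> 1) \<and>
        \<nu> ` X \<subseteq> (\<Union>i\<in>{1..n}. l i))"

definition accessible_point :: "(real ^ 2) set \<Rightarrow> real ^ 2 \<Rightarrow> bool" where
  "accessible_point Y \<xi> \<longleftrightarrow>
     \<xi> \<in> Y \<and> (\<exists>A. A homeomorphic {0..1::real} \<and> A \<inter> Y = {\<xi>})"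

end

theory Submission
  imports Defs
begin

text \<open>
  A map \<open>f\<close> of the interval gives a planar picture of one stage of the inverse limit: draw its
  graph, squeezed flat. If \<open>f\<close> stays on one side of \<open>f q\<close> on one side of
  \<open>q\<close>, then the graph leaves the point over \<open>q\<close> open to the outside, and the graph
  has an embedded strip around it with the same property (\<open>thicken_one_sided\<close>). Strips can be
  composed: an inverse system in which all bonding maps are one-sided at the coordinates of \<open>x\<close>
  gives a nested sequence of strips in the plane, whose intersection contains the embedded limit. Fast
  convergence makes the embedding thin, and the free vertical segments left over between consecutive strips
  join up to an arc that ends at the image of \<open>x\<close> (\<open>one_sided_system_embedding\<close>).

  The iterates of \<open>f\<close> are usually not one-sided at the coordinates of \<open>x\<close>, so the
  system must be replaced by another one with the same limit. The set \<open>P\<close> of post-critical points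
  is finite and invariant, and the open intervals between neighbouring points of \<open>P\<close> contain no
  turning values of any iterate. Hence near its coordinate of \<open>x\<close> an iterate is injective until
  it has covered a gap of \<open>P\<close> (\<open>branch_onto_gap\<close>). On the other hand, because
  \<open>f\<close> is locally eventually onto, some fixed iterate stretches even a third of any gap over the
  whole interval (\<open>outer_thirds_onto\<close>), so on one side of the coordinate it takes both values 0
  and 1 before leaving the gap (\<open>far_third\<close>).

  Once a map has taken an extreme value on the way from the base point, the rest of that side can be recorded
  by its values alone. This factors each bonding map \<open>\<phi>\<close> as \<open>refold\<close> after
  \<open>unfold\<close>, where \<open>unfold\<close> reaches the end of its range inside the gap. Regrouping
  the system along the intermediate intervals, the new bonding maps are \<open>unfold\<close> after the next
  \<open>refold\<close>. Such a map first follows an injective branch over the gap, and so reaches the end of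
  the range before falling below its base value. A map with this property is a composition of two one-sided
  maps (\<open>factor_one_sided\<close>): the first follows the map up to the end of the range and then runs
  on monotonically into new space, where the second replays what was left out.
\<close>

section \<open>Thickened graphs of one-sided maps\<close>

abbreviation strip :: "(real \<times> real) set" where
  "strip \<equiv> {0..1} \<times> {0..1}"

text \<open>
  On one side of \<open>p\<close> the values of \<open>f\<close> stay weakly on one side of
  \<open>f p\<close>. This is what leaves a free passage to the base point when the graph of \<open>f\<close>
  is drawn in a thin strip.
\<close>

definition one_sided_at :: "(real \<Rightarrow> real) \<Rightarrow> real \<Rightarrow> bool" where
  "one_sided_at f p \<longleftrightarrow>
     (\<forall>t\<in>{p..1}. f p \<le> f t) \<or> (\<forall>t\<in>{p..1}. f t \<le> f p) \<or>
     (\<forall>t\<in>{0..p}. f p \<le> f t) \<or> (\<forall>t\<in>{0..p}. f t \<le> f p)"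

text \<open>
  Normal form for the four cases: \<open>\<tau>\<close> orients the interval so that the good side of
  \<open>q\<close> lies above \<open>q\<close>, and \<open>b\<close> is the end of the interval towards which
  the values lean there. The end must differ from \<open>f q\<close>; if the values lean towards an end equal
  to \<open>f q\<close>, then \<open>f\<close> is constant on the good side and the other end is as good.
\<close>

lemma one_sided_normal_form:
  assumes maps: "f ` {0..1} \<subseteq> {0..1}" and q: "q \<in> {0..1}" and os: "one_sided_at f q"
  obtains b :: real and \<tau> :: "real \<Rightarrow> real" where
    "b \<in> {0, 1}" "b \<noteq> f q" "\<tau> = (\<lambda>t. t) \<or> \<tau> = (\<lambda>t. 1 - t)"
    "\<And>t. t \<in> {0..1} \<Longrightarrow> \<tau> q < \<tau> t \<Longrightarrow> 0 \<le> (f t - f q) * (b - f q)"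
proof -
  note found = that
  have range: "0 \<le> f t" "f t \<le> 1" if "t \<in> {0..1}" for t
    using maps that by (auto simp: image_subset_iff)
  have pick: thesis
    if \<tau>: "\<tau> = (\<lambda>t. t) \<or> \<tau> = (\<lambda>t. 1 - t)"
      and side: "(\<forall>t\<in>{0..1}. \<tau> q < \<tau> t \<longrightarrow> f q \<le> f t) \<or> (\<forall>t\<in>{0..1}. \<tau> q < \<tau> t \<longrightarrow> f t \<le> f q)"
    for \<tau>
  proof (cases "(\<forall>t\<in>{0..1}. \<tau> q < \<tau> t \<longrightarrow> f q \<le> f t) \<and> f q < 1")
    case True
    then show ?thesis using \<tau> by (intro found[of 1 \<tau>]) auto
  next
    case False
    have below: "f t \<le> f q" if "t \<in> {0..1}" "\<tau> q < \<tau> t" for t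
      using False side that range[of t] range[OF q] by force
    show ?thesis
    proof (cases "f q > 0")
      case True
      then show ?thesis using \<tau> below
        by (intro found[of 0 \<tau>]) (auto simp: mult_nonpos_nonneg)
    next
      case False
      then have "f q = 0" using range[OF q] by simp
      then show ?thesis using \<tau> range by (intro found[of 1 \<tau>]) auto
    qed
  qed
  have "(\<forall>t\<in>{0..1}. q < t \<longrightarrow> f q \<le> f t) \<or> (\<forall>t\<in>{0..1}. q < t \<longrightarrow> f t \<le> f q) \<or>
        (\<forall>t\<in>{0..1}. t < q \<longrightarrow> f q \<le> f t) \<or> (\<forall>t\<in>{0..1}. t < q \<longrightarrow> f t \<le> f q)"
    using os unfolding one_sided_at_def by (metis atLeastAtMost_iff less_imp_le)
  then show thesis
    using pick[of "\<lambda>t. t"] pick[of "\<lambda>t. 1 - t"] by auto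
qed

text \<open>
  The graph of \<open>f\<close>, squeezed flat, is an arc close to the image of \<open>f\<close>: its point
  over \<open>t\<close> is at \<open>(f t, \<epsilon> \<tau> t)\<close>, so the second coordinate recovers
  \<open>t\<close> and no folding of \<open>f\<close> causes a collision. A strip is fitted around it by
  moving \<open>s\<close> horizontally, with \<open>s = 0\<close> pushed towards \<open>b\<close> and
  \<open>s = 1\<close> pushed towards \<open>f q\<close>. Points that lie higher than the one over
  \<open>q\<close> have \<open>\<tau> t > \<tau> q\<close>, hence values strictly on the side of
  \<open>b\<close>, so the vertical segment above \<open>e (q, 1)\<close> is free.
\<close>

lemma thicken_one_sided:
  assumes cont: "continuous_on {0..1} f" and maps: "f ` {0..1} \<subseteq> {0..1}"
    and q: "q \<in> {0..1}" and os: "one_sided_at f q" and \<delta>: "0 < \<delta>"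
  obtains e :: "real \<times> real \<Rightarrow> real \<times> real" and y\<^sub>0 :: real where
    "continuous_on strip e" "inj_on e strip" "e ` strip \<subseteq> strip"
    "\<And>z. z \<in> strip \<Longrightarrow> dist (e z) (f (fst z), 0) \<le> \<delta>"
    "0 \<le> y\<^sub>0" "y\<^sub>0 < 1" "e (q, 1) = (f q, y\<^sub>0)"
    "\<And>y. y\<^sub>0 < y \<Longrightarrow> (f q, y) \<notin> e ` strip"
proof -
  obtain b :: real and \<tau> :: "real \<Rightarrow> real" where
    b: "b \<in> {0, 1}" "b \<noteq> f q" and \<tau>: "\<tau> = (\<lambda>t. t) \<or> \<tau> = (\<lambda>t. 1 - t)" and
    side: "\<And>t. t \<in> {0..1} \<Longrightarrow> \<tau> q < \<tau> t \<Longrightarrow> 0 \<le> (f t - f q) * (b - f q)"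
    using one_sided_normal_form[OF maps q os] by metis
  define a where "a = f q"
  define \<epsilon> where "\<epsilon> = min (\<delta> / 2) (1 / 2)"
  have \<epsilon>: "0 < \<epsilon>" "\<epsilon> \<le> 1 / 2" "\<epsilon> \<le> \<delta> / 2"
    using \<delta> by (auto simp: \<epsilon>_def)
  \<comment> \<open>The factor \<open>\<kappa>\<close> equals 1 only at \<open>q\<close>; it makes the inequality strict where \<open>f\<close> returns to \<open>f q\<close>.\<close>
  define \<kappa> where "\<kappa> t = 1 - \<bar>t - q\<bar> / 2" for t
  have \<kappa>: "0 < \<kappa> t" "\<kappa> t \<le> 1" if "t \<in> {0..1}" for t
    using that q by (auto simp: \<kappa>_def abs_if)
  have a01: "0 \<le> a" "a \<le> 1" and range: "\<And>t. t \<in> {0..1} \<Longrightarrow> 0 \<le> f t \<and> f t \<le> 1"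
    using maps q by (auto simp: a_def image_subset_iff)
  have \<tau>01: "0 \<le> \<tau> t" "\<tau> t \<le> 1" if "t \<in> {0..1}" for t
    using \<tau> that by auto
  have \<tau>_inj: "\<tau> t = \<tau> t' \<longleftrightarrow> t = t'" for t t'
    using \<tau> by auto
  define c where "c t s = b + \<kappa> t * s * (a - b)" for t s
  have c01: "0 \<le> c t s \<and> c t s \<le> 1" if "t \<in> {0..1}" "s \<in> {0..1}" for t s
  proof -
    have "0 \<le> \<kappa> t * s" "\<kappa> t * s \<le> 1"
      using \<kappa>[OF that(1)] that by (auto simp: mult_le_one)
    then have "0 \<le> \<kappa> t * s * a" "\<kappa> t * s * a \<le> 1" "0 \<le> \<kappa> t * s * (1 - a)" "\<kappa> t * s * (1 - a) \<le> 1"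
      using a01 by (auto simp: mult_le_one)
    then show ?thesis using b(1) by (auto simp: c_def algebra_simps)
  qed
  define F where "F t s = (1 - \<epsilon>) * f t + \<epsilon> * c t s" for t s
  have F01: "F t s \<in> {0..1}" if "t \<in> {0..1}" "s \<in> {0..1}" for t s
  proof -
    have "F t s \<le> (1 - \<epsilon>) * 1 + \<epsilon> * 1" unfolding F_def
      using \<epsilon> range[OF that(1)] c01[OF that] by (intro add_mono mult_left_mono) auto
    moreover have "0 \<le> F t s" unfolding F_def
      using \<epsilon> range[OF that(1)] c01[OF that] by simp
    ultimately show ?thesis by simp
  qed
  define e where "e = (\<lambda>z. (F (fst z) (snd z), \<epsilon> * \<tau> (fst z)))"
  have "continuous_on strip (\<lambda>z. f (fst z))"
    by (rule continuous_on_compose2[OF cont]) (auto intro!: continuous_intros)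
  moreover have "continuous_on strip (\<lambda>z. \<tau> (fst z))"
    using \<tau> by (auto intro!: continuous_intros)
  ultimately have e_cont: "continuous_on strip e"
    unfolding e_def F_def c_def \<kappa>_def by (intro continuous_intros) auto
  have e_inj: "inj_on e strip"
  proof (rule inj_onI)
    fix z z' assume z: "z \<in> strip" "z' \<in> strip" and eq: "e z = e z'"
    obtain t s where ts: "z = (t, s)" by (cases z)
    obtain t' s' where ts': "z' = (t', s')" by (cases z')
    have t: "t = t'" using eq \<epsilon> by (simp add: e_def ts ts' \<tau>_inj)
    then have "\<kappa> t * s * (a - b) = \<kappa> t * s' * (a - b)"
      using eq \<epsilon> by (simp add: e_def ts ts' F_def c_def)
    then show "z = z'"
      using t \<kappa>[of t] z b by (auto simp: ts ts' a_def)
  qed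
  have e_maps: "e ` strip \<subseteq> strip"
    using F01 \<tau>01 \<epsilon> by (fastforce simp: e_def intro: mult_le_one)
  have e_near: "dist (e z) (f (fst z), 0) \<le> \<delta>" if "z \<in> strip" for z
  proof -
    obtain t s where ts: "z = (t, s)" by (cases z)
    have t: "t \<in> {0..1}" "s \<in> {0..1}" using that ts by auto
    have "F t s - f t = \<epsilon> * (c t s - f t)" by (simp add: F_def algebra_simps)
    also have "\<bar>\<dots>\<bar> \<le> \<epsilon> * 1"
      using \<epsilon> range[OF t(1)] c01[OF t] by (simp add: abs_mult abs_le_iff)
    finally have 1: "\<bar>F t s - f t\<bar> \<le> \<epsilon>" by simp
    have 2: "\<bar>\<epsilon> * \<tau> t\<bar> \<le> \<epsilon>" using \<tau>01[OF t(1)] \<epsilon> by (simp add: abs_mult)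
    have "dist (e z) (f (fst z), 0) \<le> \<bar>F t s - f t\<bar> + \<bar>\<epsilon> * \<tau> t\<bar>"
      unfolding e_def ts dist_Pair_Pair fst_conv snd_conv dist_real_def
      by (smt (verit) sqrt_sum_squares_le_sum_abs power2_abs)
    then show ?thesis using 1 2 \<epsilon> by linarith
  qed
  have "\<epsilon> * \<tau> q \<le> \<epsilon>"
    using \<tau>01[OF q] \<epsilon> by (intro mult_left_le) auto
  then have y0: "0 \<le> \<epsilon> * \<tau> q" "\<epsilon> * \<tau> q < 1"
    using \<tau>01[OF q] \<epsilon> by (simp, linarith)
  have e_base: "e (q, 1) = (f q, \<epsilon> * \<tau> q)"
    by (simp add: e_def F_def c_def \<kappa>_def a_def algebra_simps)
  have e_free: "(f q, y) \<notin> e ` strip" if "\<epsilon> * \<tau> q < y" for y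
  proof
    assume "(f q, y) \<in> e ` strip"
    then obtain t s where t: "t \<in> {0..1}" "s \<in> {0..1}" and F: "F t s = a" and y: "y = \<epsilon> * \<tau> t"
      by (auto simp: e_def a_def)
    have less: "\<tau> q < \<tau> t" using that y \<epsilon> by simp
    then have "t \<noteq> q" by auto
    then have "\<kappa> t * s < 1"
      using \<kappa>[OF t(1)] t by (auto simp: \<kappa>_def intro: le_less_trans[OF mult_left_le])
    then have "0 < \<epsilon> * ((b - a)\<^sup>2 * (1 - \<kappa> t * s))"
      using b \<epsilon> by (auto simp: a_def)
    moreover have "0 \<le> (1 - \<epsilon>) * ((f t - a) * (b - a))"
      using side[OF t(1) less] \<epsilon> by (simp add: a_def)
    moreover have "(F t s - a) * (b - a) =
        (1 - \<epsilon>) * ((f t - a) * (b - a)) + \<epsilon> * ((b - a)\<^sup>2 * (1 - \<kappa> t * s))"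
      by (simp add: F_def c_def algebra_simps power2_eq_square)
    ultimately show False using F by simp
  qed
  show thesis
    by (rule that[OF e_cont e_inj e_maps e_near y0 e_base e_free])
qed

section \<open>Embedding a compactum with one-sided bonding maps\<close>

text \<open>
  An abstract compactum with compatible coordinates takes the place of the inverse limit, so that the original
  coordinates can later be exchanged for others through which they factor.
\<close>

locale projection_system =
  fixes X :: "'a::topological_space set" and \<pi> :: "nat \<Rightarrow> 'a \<Rightarrow> real"
    and g :: "nat \<Rightarrow> real \<Rightarrow> real" and x :: 'a
  assumes compact_X: "compact X" and x_in: "x \<in> X"
    and proj_cont: "continuous_on X (\<pi> n)"
    and proj_in: "\<xi> \<in> X \<Longrightarrow> \<pi> n \<xi> \<in> {0..1}"
    and bond_cont: "continuous_on {0..1} (g n)"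
    and bond_maps: "g n ` {0..1} \<subseteq> {0..1}"
    and bond_proj: "\<xi> \<in> X \<Longrightarrow> g n (\<pi> (Suc n) \<xi>) = \<pi> n \<xi>"
    and proj_separate: "\<xi> \<in> X \<Longrightarrow> \<xi>' \<in> X \<Longrightarrow> (\<And>n. \<pi> n \<xi> = \<pi> n \<xi>') \<Longrightarrow> \<xi> = \<xi>'"
    and bond_one_sided: "one_sided_at (g n) (\<pi> (Suc n) x)"
begin

text \<open>
  A coarser coordinate is a continuous function of a finer one, by way of the bonding maps.
\<close>

lemma proj_modulus:
  assumes "0 < \<epsilon>" "k \<le> n"
  shows "\<exists>d>0. \<forall>\<xi>\<in>X. \<forall>\<xi>'\<in>X. \<bar>\<pi> n \<xi> - \<pi> n \<xi>'\<bar> < d \<longrightarrow> \<bar>\<pi> k \<xi> - \<pi> k \<xi>'\<bar> < \<epsilon>"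
  using assms(2)
proof (induction n rule: dec_induct)
  case base
  then show ?case using assms(1) by blast
next
  case (step n)
  then obtain d where d: "0 < d"
    "\<And>\<xi> \<xi>'. \<xi> \<in> X \<Longrightarrow> \<xi>' \<in> X \<Longrightarrow> \<bar>\<pi> n \<xi> - \<pi> n \<xi>'\<bar> < d \<Longrightarrow> \<bar>\<pi> k \<xi> - \<pi> k \<xi>'\<bar> < \<epsilon>"
    by blast
  have "uniformly_continuous_on {0..1} (g n)"
    by (rule compact_uniformly_continuous[OF bond_cont]) simp
  then obtain d' where d': "0 < d'"
    "\<And>t t'. t \<in> {0..1} \<Longrightarrow> t' \<in> {0..1} \<Longrightarrow> dist t' t < d' \<Longrightarrow> dist (g n t') (g n t) < d"
    using \<open>0 < d\<close> unfolding uniformly_continuous_on_def by metis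
  have "\<bar>\<pi> k \<xi> - \<pi> k \<xi>'\<bar> < \<epsilon>"
    if "\<xi> \<in> X" "\<xi>' \<in> X" "\<bar>\<pi> (Suc n) \<xi> - \<pi> (Suc n) \<xi>'\<bar> < d'" for \<xi> \<xi>'
    using d(2)[OF that(1,2)] d'(2)[of "\<pi> (Suc n) \<xi>'" "\<pi> (Suc n) \<xi>"] that
    by (simp add: proj_in bond_proj dist_real_def del: atLeastAtMost_iff)
  then show ?case using d' by blast
qed

text \<open>
  At stage \<open>n\<close> the interval is cut into \<open>m\<close> equal pieces. Nearby pieces have small
  image under the core curve \<open>t \<mapsto> H (t, 0)\<close> and small influence on all earlier
  coordinates, while pieces that are not adjacent have images more than \<open>6 * \<eta>\<close> apart. So
  \<open>\<eta>\<close> is small enough that perturbations of total size \<open>2 * \<eta>\<close> in the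
  later stages destroy neither injectivity nor a chain of balls of radius \<open>3 * \<eta>\<close>.
\<close>

definition resolves :: "nat \<Rightarrow> (real \<times> real \<Rightarrow> real ^ 2) \<Rightarrow> real \<Rightarrow> bool" where
  "resolves n H \<eta> \<longleftrightarrow> (\<exists>m>0.
     (\<forall>t\<in>{0..1}. \<forall>t'\<in>{0..1}. \<bar>t - t'\<bar> \<le> 2 / real m \<longrightarrow> dist (H (t, 0)) (H (t', 0)) \<le> 1 / real (Suc n)) \<and>
     (\<forall>k\<le>n. \<forall>\<xi>\<in>X. \<forall>\<xi>'\<in>X. \<bar>\<pi> n \<xi> - \<pi> n \<xi>'\<bar> \<le> 2 / real m \<longrightarrow> \<bar>\<pi> k \<xi> - \<pi> k \<xi>'\<bar> \<le> 1 / real (Suc n)) \<and>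
     (\<forall>t\<in>{0..1}. \<forall>t'\<in>{0..1}. 1 / real m \<le> \<bar>t - t'\<bar> \<longrightarrow> 6 * \<eta> < dist (H (t, 0)) (H (t', 0))))"

lemma resolves_exists:
  assumes cont: "continuous_on strip H" and inj: "inj_on H strip" and B: "0 < B"
  obtains \<eta> where "0 < \<eta>" "\<eta> \<le> B" "resolves n H \<eta>"
proof -
  have core_cont: "continuous_on {0..1} (\<lambda>t. H (t, 0))"
    by (rule continuous_on_compose2[OF cont]) (auto intro!: continuous_intros)
  have "uniformly_continuous_on {0..1} (\<lambda>t. H (t, 0))"
    by (rule compact_uniformly_continuous[OF core_cont]) simp
  then obtain d where d: "0 < d" "\<And>t t'. t \<in> {0..1} \<Longrightarrow> t' \<in> {0..1} \<Longrightarrow> dist t' t < d \<Longrightarrow>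
      dist (H (t', 0)) (H (t, 0)) < 1 / real (Suc n)"
    unfolding uniformly_continuous_on_def by (metis zero_less_divide_1_iff of_nat_0_less_iff zero_less_Suc)
  have "\<exists>d>0. \<forall>\<xi>\<in>X. \<forall>\<xi>'\<in>X. \<bar>\<pi> n \<xi> - \<pi> n \<xi>'\<bar> < d \<longrightarrow> \<bar>\<pi> k \<xi> - \<pi> k \<xi>'\<bar> < 1 / real (Suc n)"
    if "k \<le> n" for k
    using proj_modulus[OF _ that] by simp
  then obtain D where D: "\<And>k. k \<le> n \<Longrightarrow> 0 < D k" "\<And>k \<xi> \<xi>'. k \<le> n \<Longrightarrow> \<xi> \<in> X \<Longrightarrow> \<xi>' \<in> X \<Longrightarrow>
      \<bar>\<pi> n \<xi> - \<pi> n \<xi>'\<bar> < D k \<Longrightarrow> \<bar>\<pi> k \<xi> - \<pi> k \<xi>'\<bar> < 1 / real (Suc n)"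
    by metis
  define r where "r = min d (Min (D ` {..n}))"
  have "0 < r" using d D by (simp add: r_def)
  then obtain m\<^sub>0 where "inverse (real (Suc m\<^sub>0)) < r / 2"
    using reals_Archimedean[of "r / 2"] by auto
  then obtain m :: nat where m: "0 < m" "2 / real m < r"
    by (intro that[of "Suc m\<^sub>0"]) (auto simp: field_simps)
  have r_le: "r \<le> d" "\<And>k. k \<le> n \<Longrightarrow> r \<le> D k"
    by (auto simp: r_def intro!: min.coboundedI2 Min_le)
  define K where "K = {w \<in> {0..1} \<times> {0..1}. 1 / real m \<le> \<bar>fst w - snd w\<bar>}"
  have "compact (({0..1} \<times> {0..1}) \<inter> {w :: real \<times> real. 1 / real m \<le> \<bar>fst w - snd w\<bar>})"
    by (intro compact_Int_closed compact_Times compact_Icc closed_Collect_le continuous_intros)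
  then have K: "compact K" by (simp add: K_def Int_def)
  have "(0, 1) \<in> K" using m by (simp add: K_def)
  moreover have "continuous_on K (\<lambda>w. dist (H (fst w, 0)) (H (snd w, 0)))"
    by (intro continuous_intros continuous_on_compose2[OF core_cont]) (auto simp: K_def)
  ultimately obtain w where w: "w \<in> K"
    "\<And>v. v \<in> K \<Longrightarrow> dist (H (fst w, 0)) (H (snd w, 0)) \<le> dist (H (fst v, 0)) (H (snd v, 0))"
    using continuous_attains_inf[OF K] by blast
  define gap where "gap = dist (H (fst w, 0)) (H (snd w, 0))"
  have "fst w \<noteq> snd w" using w m by (auto simp: K_def)
  then have "0 < gap"
    using inj_onD[OF inj, of "(fst w, 0)" "(snd w, 0)"] w by (auto simp: gap_def K_def)
  define \<eta> where "\<eta> = min B (gap / 7)"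
  have \<eta>: "0 < \<eta>" "\<eta> \<le> B" "6 * \<eta> < gap"
    using \<open>0 < gap\<close> B by (auto simp: \<eta>_def)
  have "resolves n H \<eta>"
    unfolding resolves_def
  proof (intro exI[of _ m] conjI allI ballI impI)
    fix t t' :: real assume t: "t \<in> {0..1}" "t' \<in> {0..1}"
    { assume "\<bar>t - t'\<bar> \<le> 2 / real m"
      then show "dist (H (t, 0)) (H (t', 0)) \<le> 1 / real (Suc n)"
        using d(2)[OF t(2,1)] m r_le(1) by (simp add: dist_real_def del: of_nat_Suc) }
    { assume "1 / real m \<le> \<bar>t - t'\<bar>"
      then have "(t, t') \<in> K" using t by (simp add: K_def)
      then show "6 * \<eta> < dist (H (t, 0)) (H (t', 0))"
        using w(2) \<eta>(3) by (fastforce simp: gap_def) }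
  next
    fix k \<xi> \<xi>' assume "k \<le> n" "\<xi> \<in> X" "\<xi>' \<in> X" "\<bar>\<pi> n \<xi> - \<pi> n \<xi>'\<bar> \<le> 2 / real m"
    then show "\<bar>\<pi> k \<xi> - \<pi> k \<xi>'\<bar> \<le> 1 / real (Suc n)"
      using D(2)[of k \<xi> \<xi>'] m r_le(2)[of k] by simp
  qed (use m in auto)
  then show thesis using that \<eta> by blast
qed

end

text \<open>
  A nested sequence of embedded strips. The next strip follows the core curve of the current one along the
  bonding map. Over the base point, the part of the current column above height \<open>y n\<close> is disjoint
  from the next strip, and its lower end is the top of the next base column; these pieces concatenate to an
  access path.
\<close>

locale strip_tower = projection_system +
  fixes H :: "nat \<Rightarrow> real \<times> real \<Rightarrow> real ^ 2" and \<eta> y :: "nat \<Rightarrow> real"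
  assumes H_cont: "continuous_on strip (H n)" and H_inj: "inj_on (H n) strip"
    and \<eta>_pos: "0 < \<eta> n" and \<eta>_le: "\<eta> n \<le> 1 / real (Suc n)" and \<eta>_half: "\<eta> (Suc n) \<le> \<eta> n / 2"
    and H_resolves: "resolves n (H n) (\<eta> n)"
    and H_nested: "H (Suc n) ` strip \<subseteq> H n ` strip"
    and H_near: "z \<in> strip \<Longrightarrow> dist (H (Suc n) z) (H n (g n (fst z), 0)) \<le> \<eta> n"
    and y_range: "0 \<le> y n" "y n < 1"
    and H_base: "H (Suc n) (\<pi> (Suc n) x, 1) = H n (\<pi> n x, y n)"
    and H_free: "y n < s \<Longrightarrow> s \<le> 1 \<Longrightarrow> H n (\<pi> n x, s) \<notin> H (Suc n) ` strip"

context projection_system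
begin

lemma tower_step:
  assumes cont: "continuous_on strip H" and inj: "inj_on H strip" and \<eta>: "0 < \<eta>"
  obtains H' \<eta>' y where
    "continuous_on strip H'" "inj_on H' strip" "0 < \<eta>'" "\<eta>' \<le> 1 / real (Suc (Suc n))" "\<eta>' \<le> \<eta> / 2"
    "resolves (Suc n) H' \<eta>'" "H' ` strip \<subseteq> H ` strip"
    "\<And>z. z \<in> strip \<Longrightarrow> dist (H' z) (H (g n (fst z), 0)) \<le> \<eta>"
    "0 \<le> y" "y < 1" "H' (\<pi> (Suc n) x, 1) = H (\<pi> n x, y)"
    "\<And>s. y < s \<Longrightarrow> s \<le> 1 \<Longrightarrow> H (\<pi> n x, s) \<notin> H' ` strip"
proof -
  have "uniformly_continuous_on strip H"
    by (intro compact_uniformly_continuous[OF cont] compact_Times compact_Icc)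
  then obtain \<delta> where \<delta>: "0 < \<delta>"
    "\<And>z z'. z \<in> strip \<Longrightarrow> z' \<in> strip \<Longrightarrow> dist z' z < \<delta> \<Longrightarrow> dist (H z') (H z) < \<eta>"
    using \<eta> unfolding uniformly_continuous_on_def by metis
  obtain e y where e: "continuous_on strip e" "inj_on e strip" "e ` strip \<subseteq> strip"
    and near: "\<And>z. z \<in> strip \<Longrightarrow> dist (e z) (g n (fst z), 0) \<le> \<delta> / 2"
    and y: "0 \<le> y" "y < 1" and base: "e (\<pi> (Suc n) x, 1) = (g n (\<pi> (Suc n) x), y)"
    and free: "\<And>s. y < s \<Longrightarrow> (g n (\<pi> (Suc n) x), s) \<notin> e ` strip"
    using thicken_one_sided[OF bond_cont bond_maps proj_in[OF x_in] bond_one_sided half_gt_zero[OF \<open>0 < \<delta>\<close>]]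
    by (metis (no_types, lifting))
  define H' where "H' = H \<circ> e"
  have H'_cont: "continuous_on strip H'" unfolding H'_def
    by (rule continuous_on_compose[OF e(1) continuous_on_subset[OF cont e(3)]])
  have H'_inj: "inj_on H' strip" unfolding H'_def
    by (rule comp_inj_on[OF e(2) inj_on_subset[OF inj e(3)]])
  obtain \<eta>' where \<eta>': "0 < \<eta>'" "\<eta>' \<le> min (1 / real (Suc (Suc n))) (\<eta> / 2)" "resolves (Suc n) H' \<eta>'"
    by (rule resolves_exists[OF H'_cont H'_inj, of "min (1 / real (Suc (Suc n))) (\<eta> / 2)" "Suc n"])
       (use \<eta> in auto)
  have "dist (H' z) (H (g n (fst z), 0)) \<le> \<eta>" if "z \<in> strip" for z
  proof -
    have "g n (fst z) \<in> {0..1}" using bond_maps[of n] that by (auto simp: image_subset_iff)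
    then have "(g n (fst z), 0) \<in> strip" by simp
    moreover have "e z \<in> strip" using e(3) that by blast
    moreover have "dist (e z) (g n (fst z), 0) < \<delta>" using near[OF that] \<delta>(1) by simp
    ultimately show ?thesis unfolding H'_def comp_def using \<delta>(2) by (meson less_imp_le)
  qed
  moreover have "H (\<pi> n x, s) \<notin> H' ` strip" if "y < s" "s \<le> 1" for s
  proof
    assume "H (\<pi> n x, s) \<in> H' ` strip"
    then obtain z where z: "z \<in> strip" "H (\<pi> n x, s) = H (e z)" by (auto simp: H'_def)
    have "(\<pi> n x, s) = e z"
      using z e(3) that y proj_in[OF x_in, of n] by (intro inj_onD[OF inj z(2)]) auto
    then show False using free[OF that(1)] z(1) bond_proj[OF x_in, of n] by auto
  qed
  moreover have "H' ` strip \<subseteq> H ` strip" using e(3) by (auto simp: H'_def)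
  moreover have "H' (\<pi> (Suc n) x, 1) = H (\<pi> n x, y)"
    using base bond_proj[OF x_in] by (simp add: H'_def)
  ultimately show thesis
    using that[OF H'_cont H'_inj \<eta>'(1) _ _ \<eta>'(3) _ _ y] \<eta>'(2) by simp
qed

lemma tower_exists: "\<exists>H \<eta> y. strip_tower X \<pi> g x H \<eta> y"
proof -
  define good where "good n p \<longleftrightarrow> continuous_on strip (fst p) \<and> inj_on (fst p) strip \<and>
      0 < snd p \<and> snd p \<le> 1 / real (Suc n) \<and> resolves n (fst p) (snd p)" for n and p :: "(real \<times> real \<Rightarrow> real ^ 2) \<times> real"
  define finer where "finer n p p' \<longleftrightarrow> snd p' \<le> snd p / 2 \<and> fst p' ` strip \<subseteq> fst p ` strip \<and>
      (\<forall>z\<in>strip. dist (fst p' z) (fst p (g n (fst z), 0)) \<le> snd p) \<and>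
      (\<exists>y. 0 \<le> y \<and> y < 1 \<and> fst p' (\<pi> (Suc n) x, 1) = fst p (\<pi> n x, y) \<and>
        (\<forall>s. y < s \<longrightarrow> s \<le> 1 \<longrightarrow> fst p (\<pi> n x, s) \<notin> fst p' ` strip))"
    for n and p p' :: "(real \<times> real \<Rightarrow> real ^ 2) \<times> real"
  define H\<^sub>0 :: "real \<times> real \<Rightarrow> real ^ 2" where "H\<^sub>0 z = fst z *\<^sub>R axis 1 1 + snd z *\<^sub>R axis 2 1" for z
  have H\<^sub>0: "continuous_on strip H\<^sub>0"
    unfolding H\<^sub>0_def by (intro continuous_intros)
  have "H\<^sub>0 z $ 1 = fst z" "H\<^sub>0 z $ 2 = snd z" for z
    by (auto simp: H\<^sub>0_def axis_def)
  then have "inj_on H\<^sub>0 strip"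
    by (metis inj_onI prod_eqI)
  then obtain \<eta>\<^sub>0 where "0 < \<eta>\<^sub>0" "\<eta>\<^sub>0 \<le> 1" "resolves 0 H\<^sub>0 \<eta>\<^sub>0"
    using resolves_exists[OF H\<^sub>0, of 1 0] by auto
  then have "\<exists>p. good 0 p"
    using H\<^sub>0 \<open>inj_on H\<^sub>0 strip\<close> by (intro exI[of _ "(H\<^sub>0, \<eta>\<^sub>0)"]) (auto simp: good_def)
  moreover have "\<exists>p'. good (Suc n) p' \<and> finer n p p'" if "good n p" for n p
  proof -
    obtain H' \<eta>' y where
      "continuous_on strip H'" "inj_on H' strip" "0 < \<eta>'" "\<eta>' \<le> 1 / real (Suc (Suc n))"
      "\<eta>' \<le> snd p / 2" "resolves (Suc n) H' \<eta>'" "H' ` strip \<subseteq> fst p ` strip"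
      "\<And>z. z \<in> strip \<Longrightarrow> dist (H' z) (fst p (g n (fst z), 0)) \<le> snd p"
      "0 \<le> y" "y < 1" "H' (\<pi> (Suc n) x, 1) = fst p (\<pi> n x, y)"
      "\<And>s. y < s \<Longrightarrow> s \<le> 1 \<Longrightarrow> fst p (\<pi> n x, s) \<notin> H' ` strip"
      using tower_step[of "fst p" "snd p" n] \<open>good n p\<close> unfolding good_def by metis
    then show ?thesis
      by (intro exI[of _ "(H', \<eta>')"]) (auto simp: good_def finer_def)
  qed
  ultimately obtain P where P: "\<And>n. good n (P n)" "\<And>n. finer n (P n) (P (Suc n))"
    using dependent_nat_choice[of good finer] by metis
  have "\<exists>y. \<forall>n. 0 \<le> y n \<and> y n < 1 \<and> fst (P (Suc n)) (\<pi> (Suc n) x, 1) = fst (P n) (\<pi> n x, y n) \<and>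
        (\<forall>s. y n < s \<longrightarrow> s \<le> 1 \<longrightarrow> fst (P n) (\<pi> n x, s) \<notin> fst (P (Suc n)) ` strip)"
    using P(2) unfolding finer_def by (intro choice allI) blast
  then obtain y where "\<And>n. 0 \<le> y n \<and> y n < 1 \<and> fst (P (Suc n)) (\<pi> (Suc n) x, 1) = fst (P n) (\<pi> n x, y n) \<and>
        (\<forall>s. y n < s \<longrightarrow> s \<le> 1 \<longrightarrow> fst (P n) (\<pi> n x, s) \<notin> fst (P (Suc n)) ` strip)"
    by blast
  then have "strip_tower X \<pi> g x (\<lambda>n. fst (P n)) (\<lambda>n. snd (P n)) y"
    using P unfolding good_def finer_def by unfold_locales auto
  then show ?thesis by blast
qed

end

text \<open>
  If the steps are bounded by a sequence that at least halves each time, the tail after stage \<open>n\<close>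
  adds at most twice the current bound.
\<close>

lemma halving_limit:
  fixes u :: "nat \<Rightarrow> 'b::topological_space \<Rightarrow> 'c::complete_space"
  assumes cont: "\<And>n. continuous_on A (u n)"
    and step: "\<And>n z. z \<in> A \<Longrightarrow> dist (u (Suc n) z) (u n z) \<le> r n"
    and half: "\<And>n. r (Suc n) \<le> r n / 2"
  obtains l where "continuous_on A l" "\<And>n z. z \<in> A \<Longrightarrow> dist (l z) (u n z) \<le> 2 * r n"
    "\<And>z. z \<in> A \<Longrightarrow> (\<lambda>n. u n z) \<longlonglongrightarrow> l z"
proof -
  have far: "dist (u (n + k) z) (u n z) \<le> 2 * r n - 2 * r (n + k)" if "z \<in> A" for n k z
  proof (induction k)
    case (Suc k)
    have "dist (u (n + Suc k) z) (u n z) \<le> dist (u (Suc (n + k)) z) (u (n + k) z) + dist (u (n + k) z) (u n z)"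
      using dist_triangle[of _ _ "u (n + k) z"] by simp
    also have "\<dots> \<le> r (n + k) + (2 * r n - 2 * r (n + k))"
      using step[OF that, of "n + k"] Suc by linarith
    also have "\<dots> \<le> 2 * r n - 2 * r (n + Suc k)"
      using half[of "n + k"] by simp
    finally show ?case .
  qed simp
  have r_nonneg: "0 \<le> r n" if "z \<in> A" for n z
    using step[OF that, of n] zero_le_dist order_trans by blast
  have r_le: "r n \<le> \<bar>r 0\<bar> / 2 ^ n" for n
  proof (induction n)
    case (Suc n)
    have "r (Suc n) \<le> (\<bar>r 0\<bar> / 2 ^ n) / 2"
      using Suc by (intro order_trans[OF half] divide_right_mono) auto
    then show ?case by (simp add: mult.commute)
  qed simp
  have near: "dist (u m z) (u n z) \<le> 2 * r n" if "z \<in> A" "n \<le> m" for m n z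
    using far[OF that(1), of n "m - n"] r_nonneg[OF that(1), of m] that(2) by simp
  have r_small: "\<exists>N. \<forall>n\<ge>N. 2 * r n < e" if "0 < e" for e
  proof -
    have "(\<lambda>n. 2 * (\<bar>r 0\<bar> / 2 ^ n)) \<longlonglongrightarrow> 2 * 0"
      by (intro tendsto_mult tendsto_const LIMSEQ_divide_realpow_zero) auto
    then have "\<forall>\<^sub>F n in sequentially. 2 * (\<bar>r 0\<bar> / 2 ^ n) < e"
      using that by (simp add: order_tendsto_iff)
    then show ?thesis
      unfolding eventually_sequentially using r_le by (smt (verit))
  qed
  have "uniformly_Cauchy_on A u"
  proof (rule uniformly_Cauchy_onI')
    fix e :: real assume "0 < e"
    then obtain N where "\<And>n. n \<ge> N \<Longrightarrow> 2 * r n < e" using r_small by blast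
    then show "\<exists>M. \<forall>z\<in>A. \<forall>m\<ge>M. \<forall>n>m. dist (u m z) (u n z) < e"
      using near by (metis dist_commute le_less_trans less_imp_le)
  qed
  then obtain l where l: "uniform_limit A u l sequentially"
    using Cauchy_uniformly_convergent uniformly_convergent_on_def by blast
  have lim: "(\<lambda>n. u n z) \<longlonglongrightarrow> l z" if "z \<in> A" for z
    using tendsto_uniform_limitI[OF l that] .
  have "dist (l z) (u n z) \<le> 2 * r n" if "z \<in> A" for n z
  proof (subst dist_commute, rule Lim_dist_ubound[OF sequentially_bot])
    show "(\<lambda>m. u m z) \<longlonglongrightarrow> l z" by (rule lim[OF that])
    show "\<forall>\<^sub>F m in sequentially. dist (u n z) (u m z) \<le> 2 * r n"
      using eventually_ge_at_top[of n] by eventually_elim (subst dist_commute, rule near[OF that])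
  qed
  moreover have "continuous_on A l"
    by (rule uniform_limit_theorem[OF _ l]) (use cont in auto)
  ultimately show thesis using that lim by blast
qed

context strip_tower
begin

lemma \<eta>_tendsto: "\<eta> \<longlonglongrightarrow> 0"
proof (rule Lim_null_comparison[OF _ LIMSEQ_inverse_real_of_nat])
  show "\<forall>\<^sub>F n in sequentially. norm (\<eta> n) \<le> inverse (real (Suc n))"
    using \<eta>_le less_imp_le[OF \<eta>_pos] by (simp only: real_norm_def abs_of_nonneg inverse_eq_divide eventually_True)
qed

lemma H_antimono: "m \<le> n \<Longrightarrow> H n ` strip \<subseteq> H m ` strip"
  by (rule lift_Suc_antimono_le[of "\<lambda>n. H n ` strip"]) (rule H_nested)

lemma core_cont: "continuous_on X (\<lambda>\<xi>. H n (\<pi> n \<xi>, 0))"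
  by (rule continuous_on_compose2[OF H_cont]) (use proj_in in \<open>auto intro!: continuous_intros proj_cont\<close>)

text \<open>
  Whole columns of the next strip, not only its core, stay close to the current core. This forces the pieces
  of the access path to shrink.
\<close>

lemma column_near_core:
  assumes "\<xi> \<in> X" "s \<in> {0..1}"
  shows "dist (H (Suc n) (\<pi> (Suc n) \<xi>, s)) (H n (\<pi> n \<xi>, 0)) \<le> \<eta> n"
  using H_near[of "(\<pi> (Suc n) \<xi>, s)" n] proj_in[OF assms(1), of "Suc n"] bond_proj[OF assms(1), of n] assms(2)
  by simp

lemma limit_map_exists:
  obtains \<nu> where "continuous_on X \<nu>" "\<And>n \<xi>. \<xi> \<in> X \<Longrightarrow> dist (\<nu> \<xi>) (H n (\<pi> n \<xi>, 0)) \<le> 2 * \<eta> n"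
proof (rule halving_limit[of X "\<lambda>n \<xi>. H n (\<pi> n \<xi>, 0)" \<eta>])
  show "dist (H (Suc n) (\<pi> (Suc n) \<xi>, 0)) (H n (\<pi> n \<xi>, 0)) \<le> \<eta> n" if "\<xi> \<in> X" for n \<xi>
    by (rule column_near_core[OF that]) simp
qed (rule core_cont \<eta>_half that; assumption)+

end

locale strip_tower_limit = strip_tower +
  fixes \<nu> :: "'a \<Rightarrow> real ^ 2"
  assumes \<nu>_cont: "continuous_on X \<nu>"
    and \<nu>_near: "\<xi> \<in> X \<Longrightarrow> dist (\<nu> \<xi>) (H n (\<pi> n \<xi>, 0)) \<le> 2 * \<eta> n"
begin

lemma core_tendsto:
  assumes "\<xi> \<in> X"
  shows "(\<lambda>n. H n (\<pi> n \<xi>, 0)) \<longlonglongrightarrow> \<nu> \<xi>"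
proof -
  have "(\<lambda>n. 2 * \<eta> n) \<longlonglongrightarrow> 0" using tendsto_mult_right_zero[OF \<eta>_tendsto] by simp
  then have "(\<lambda>n. dist (H n (\<pi> n \<xi>, 0)) (\<nu> \<xi>)) \<longlonglongrightarrow> 0"
    by (rule Lim_null_comparison[rotated]) (use \<nu>_near[OF assms] in \<open>simp add: dist_commute\<close>)
  then show ?thesis by (rule iffD2[OF tendsto_dist_iff])
qed

lemma limit_in_strip:
  assumes "\<xi> \<in> X"
  shows "\<nu> \<xi> \<in> H n ` strip"
proof (rule Lim_in_closed_set)
  show "closed (H n ` strip)"
    by (intro compact_imp_closed compact_continuous_image H_cont compact_Times compact_Icc)
  show "(\<lambda>k. H k (\<pi> k \<xi>, 0)) \<longlonglongrightarrow> \<nu> \<xi>" by (rule core_tendsto[OF assms])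
  show "\<forall>\<^sub>F k in sequentially. H k (\<pi> k \<xi>, 0) \<in> H n ` strip"
    using eventually_ge_at_top[of n]
  proof eventually_elim
    fix k assume "n \<le> k"
    have "(\<pi> k \<xi>, 0) \<in> strip" using proj_in[OF assms] by simp
    then show "H k (\<pi> k \<xi>, 0) \<in> H n ` strip" using H_antimono[OF \<open>n \<le> k\<close>] by blast
  qed
qed simp

lemma limit_inj: "inj_on \<nu> X"
proof (rule inj_onI, rule proj_separate)
  fix \<xi> \<xi>' k assume \<xi>: "\<xi> \<in> X" "\<xi>' \<in> X" and eq: "\<nu> \<xi> = \<nu> \<xi>'"
  have close: "\<bar>\<pi> k \<xi> - \<pi> k \<xi>'\<bar> \<le> 1 / real (Suc n)" if "k \<le> n" for n
  proof -
    obtain m :: nat where m: "0 < m"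
      "\<And>t t'. t \<in> {0..1} \<Longrightarrow> t' \<in> {0..1} \<Longrightarrow> 1 / real m \<le> \<bar>t - t'\<bar> \<Longrightarrow> 6 * \<eta> n < dist (H n (t, 0)) (H n (t', 0))"
      "\<And>k. k \<le> n \<Longrightarrow> \<bar>\<pi> n \<xi> - \<pi> n \<xi>'\<bar> \<le> 2 / real m \<Longrightarrow> \<bar>\<pi> k \<xi> - \<pi> k \<xi>'\<bar> \<le> 1 / real (Suc n)"
      using H_resolves[of n] \<xi> unfolding resolves_def by blast
    have "dist (H n (\<pi> n \<xi>, 0)) (H n (\<pi> n \<xi>', 0)) \<le> 4 * \<eta> n"
      using \<nu>_near[OF \<xi>(1), of n] \<nu>_near[OF \<xi>(2), of n] eq
        dist_triangle3[of "H n (\<pi> n \<xi>, 0)" "H n (\<pi> n \<xi>', 0)" "\<nu> \<xi>"] by simp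
    then have "\<bar>\<pi> n \<xi> - \<pi> n \<xi>'\<bar> < 1 / real m"
      using m(2)[OF proj_in[OF \<xi>(1), of n] proj_in[OF \<xi>(2), of n]] \<eta>_pos[of n] by force
    also have "\<dots> \<le> 2 / real m" using m(1) by (simp add: divide_right_mono)
    finally show ?thesis using m(3)[OF that] by simp
  qed
  have "\<bar>\<pi> k \<xi> - \<pi> k \<xi>'\<bar> \<le> 0"
  proof (rule tendsto_lowerbound[OF LIMSEQ_inverse_real_of_nat _ sequentially_bot])
    show "\<forall>\<^sub>F n in sequentially. \<bar>\<pi> k \<xi> - \<pi> k \<xi>'\<bar> \<le> inverse (real (Suc n))"
      using eventually_ge_at_top[of k] by eventually_elim (use close in \<open>simp add: inverse_eq_divide\<close>)
  qed
  then show "\<pi> k \<xi> = \<pi> k \<xi>'" by simp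
qed auto

text \<open>
  Link \<open>i\<close> is the union of the balls of radius \<open>3 * \<eta> n\<close> around the image of
  the piece \<open>[(i - 1) / m, i / m]\<close> under the core curve. The limit set stays within
  \<open>2 * \<eta> n\<close> of that curve.
\<close>

lemma chain_cover:
  assumes "0 < \<epsilon>"
  shows "\<exists>n (l :: nat \<Rightarrow> (real ^ 2) set).
        (\<forall>i\<in>{1..n}. l i \<noteq> {} \<and> open (l i) \<and> connected (l i) \<and>
           bounded (l i) \<and> diameter (l i) < \<epsilon>) \<and>
        (\<forall>i\<in>{1..n}. \<forall>j\<in>{1..n}. l i \<inter> l j \<noteq> {} \<longleftrightarrow> \<bar>int i - int j\<bar> \<le> 1) \<and>
        \<nu> ` X \<subseteq> (\<Union>i\<in>{1..n}. l i)"
proof -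
  obtain n where "inverse (real (Suc n)) < \<epsilon> / 7"
    using reals_Archimedean[of "\<epsilon> / 7"] assms by (meson divide_pos_pos zero_less_numeral)
  then have "7 * inverse (real (Suc n)) < \<epsilon>" by linarith
  then have n: "7 / real (Suc n) < \<epsilon>" by (simp only: divide_inverse)
  obtain m :: nat where m: "0 < m"
    and fine: "\<And>t t'. t \<in> {0..1} \<Longrightarrow> t' \<in> {0..1} \<Longrightarrow> \<bar>t - t'\<bar> \<le> 2 / real m \<Longrightarrow>
        dist (H n (t, 0)) (H n (t', 0)) \<le> 1 / real (Suc n)"
    and apart: "\<And>t t'. t \<in> {0..1} \<Longrightarrow> t' \<in> {0..1} \<Longrightarrow> 1 / real m \<le> \<bar>t - t'\<bar> \<Longrightarrow>
        6 * \<eta> n < dist (H n (t, 0)) (H n (t', 0))"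
    using H_resolves[of n] unfolding resolves_def by blast
  define piece where "piece i = {(real i - 1) / real m..real i / real m}" for i
  define \<gamma> where "\<gamma> t = H n (t, 0)" for t
  define l where "l i = (\<Union>t\<in>piece i. ball (\<gamma> t) (3 * \<eta> n))" for i
  have \<gamma>_cont: "continuous_on {0..1} \<gamma>"
    unfolding \<gamma>_def by (rule continuous_on_compose2[OF H_cont]) (auto intro!: continuous_intros)
  have piece_sub: "piece i \<subseteq> {0..1}" if "i \<in> {1..m}" for i
    using that m by (auto simp: piece_def field_simps)
  have ends: "(real i - 1) / real m \<in> piece i" "real i / real m \<in> piece i" for i
    using m by (auto simp: piece_def divide_right_mono)
  have width: "\<bar>t - t'\<bar> \<le> 1 / real m" if "t \<in> piece i" "t' \<in> piece i" for t t' i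
    using that by (auto simp: piece_def diff_divide_distrib)
  have l_dist: "dist a b \<le> 7 / real (Suc n)" if i: "i \<in> {1..m}" and ab: "a \<in> l i" "b \<in> l i" for i a b
  proof -
    obtain t t' where t: "t \<in> piece i" "dist (\<gamma> t) a < 3 * \<eta> n" "t' \<in> piece i" "dist (\<gamma> t') b < 3 * \<eta> n"
      using ab by (auto simp: l_def)
    have "1 / real m \<le> 2 / real m" by (simp add: divide_right_mono)
    then have "dist (\<gamma> t) (\<gamma> t') \<le> 1 / real (Suc n)"
      unfolding \<gamma>_def using piece_sub[OF i] t width[OF t(1,3)] by (intro fine) auto
    moreover have "dist a b \<le> dist (\<gamma> t) a + dist (\<gamma> t) (\<gamma> t') + dist (\<gamma> t') b"
      by (smt (verit) dist_commute dist_triangle)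
    ultimately have "dist a b \<le> 6 * \<eta> n + 1 / real (Suc n)" using t by linarith
    also have "\<dots> \<le> 6 * (1 / real (Suc n)) + 1 / real (Suc n)" using \<eta>_le[of n] by simp
    finally show ?thesis by simp
  qed
  have link: "l i \<noteq> {} \<and> open (l i) \<and> connected (l i) \<and> bounded (l i) \<and> diameter (l i) < \<epsilon>"
    if i: "i \<in> {1..m}" for i
  proof (intro conjI)
    have core: "\<gamma> ` piece i \<subseteq> l i" using \<eta>_pos[of n] by (auto simp: l_def)
    then show "l i \<noteq> {}" using ends by blast
    show "open (l i)" by (auto simp: l_def)
    have "connected (\<gamma> ` piece i \<union> \<Union> ((\<lambda>t. ball (\<gamma> t) (3 * \<eta> n)) ` piece i))"
      using \<eta>_pos[of n] continuous_on_subset[OF \<gamma>_cont piece_sub[OF i]]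
      by (intro connected_Un_UN connected_continuous_image) (auto simp: piece_def)
    then show "connected (l i)" using core by (simp add: l_def Un_absorb1)
    show "bounded (l i)" using l_dist[OF i] by (auto simp: bounded_two_points)
    have "diameter (l i) \<le> 7 / real (Suc n)"
      using l_dist[OF i] by (intro diameter_le) (auto simp: dist_norm)
    then show "diameter (l i) < \<epsilon>" using n by simp
  qed
  have meet: "l i \<inter> l j \<noteq> {} \<longleftrightarrow> \<bar>int i - int j\<bar> \<le> 1" if ij: "i \<in> {1..m}" "j \<in> {1..m}" for i j
  proof
    assume "\<bar>int i - int j\<bar> \<le> 1"
    then consider "i = j" | "j = Suc i" | "i = Suc j" by linarith
    then have "\<exists>t. t \<in> piece i \<and> t \<in> piece j"
    proof cases
      case 1 then show ?thesis using ends by blast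
    next
      case 2 then show ?thesis using ends[of i] ends[of j] by (intro exI[of _ "real i / real m"]) simp
    next
      case 3 then show ?thesis using ends[of i] ends[of j] by (intro exI[of _ "real j / real m"]) simp
    qed
    then obtain t where t: "t \<in> piece i" "t \<in> piece j" by blast
    have "\<gamma> t \<in> l i" "\<gamma> t \<in> l j"
      unfolding l_def using t \<eta>_pos[of n] by (intro UN_I[of t]; simp)+
    then show "l i \<inter> l j \<noteq> {}" by blast
  next
    assume "l i \<inter> l j \<noteq> {}"
    then obtain t t' a where t: "t \<in> piece i" "t' \<in> piece j" "dist (\<gamma> t) a < 3 * \<eta> n" "dist (\<gamma> t') a < 3 * \<eta> n"
      by (auto simp: l_def)
    then have "dist (\<gamma> t) (\<gamma> t') < 6 * \<eta> n"
      using dist_triangle2[of "\<gamma> t" "\<gamma> t'" a] by simp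
    then have "\<not> 6 * \<eta> n < dist (H n (t, 0)) (H n (t', 0))" by (simp add: \<gamma>_def)
    moreover have "t \<in> {0..1}" "t' \<in> {0..1}"
      using t(1,2) piece_sub[OF ij(1)] piece_sub[OF ij(2)] by blast+
    ultimately have "\<bar>t - t'\<bar> < 1 / real m" using apart not_less by blast
    then have "\<bar>t - t'\<bar> * real m < 1"
      using m by (simp add: pos_less_divide_eq)
    moreover have "\<bar>t - t'\<bar> * real m = \<bar>t * m - t' * m\<bar>"
      by (simp only: left_diff_distrib[symmetric] abs_mult abs_of_nat)
    ultimately have "\<bar>t * m - t' * m\<bar> < 1" by simp
    moreover have "real i - 1 \<le> t * m" "t * m \<le> real i" "real j - 1 \<le> t' * m" "t' * m \<le> real j"
      using t(1,2) m by (auto simp: piece_def field_simps)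
    ultimately show "\<bar>int i - int j\<bar> \<le> 1" by linarith
  qed
  have cover: "\<nu> ` X \<subseteq> (\<Union>i\<in>{1..m}. l i)"
  proof
    fix z assume "z \<in> \<nu> ` X"
    then obtain \<xi> where \<xi>: "\<xi> \<in> X" "z = \<nu> \<xi>" by blast
    define t where "t = \<pi> n \<xi>"
    have t: "0 \<le> t" "t \<le> 1" using proj_in[OF \<xi>(1), of n] by (auto simp: t_def)
    define i where "i = max 1 (nat \<lceil>t * m\<rceil>)"
    have tm: "0 \<le> t * m" "t * m \<le> m" using t by (auto simp: mult_left_le_one_le)
    have "real i - 1 \<le> t * m" "t * m \<le> real i"
      using tm unfolding i_def by linarith+
    then have "t \<in> piece i" using m by (simp add: piece_def field_simps)
    moreover have "i \<in> {1..m}" using tm m by (simp add: i_def)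
    moreover have "dist (\<gamma> t) z < 3 * \<eta> n"
      using \<nu>_near[OF \<xi>(1), of n] \<eta>_pos[of n] by (simp add: \<xi> \<gamma>_def t_def dist_commute)
    ultimately show "z \<in> (\<Union>i\<in>{1..m}. l i)" by (auto simp: l_def)
  qed
  show ?thesis using link meet cover by blast
qed

lemma limit_thin: "thin_planar_embedding X \<nu>"
proof -
  obtain h where "homeomorphism X (\<nu> ` X) \<nu> h"
    using homeomorphism_compact[OF compact_X \<nu>_cont refl limit_inj] by blast
  then show ?thesis
    unfolding thin_planar_embedding_def planar_embedding_def using chain_cover by blast
qed

text \<open>
  The path that runs, on \<open>[1 / 2 ^ Suc k, 1 / 2 ^ k]\<close> for \<open>k < n\<close>, down the free
  part of the base column of strip \<open>k\<close> as the time decreases, and rests at the top of the base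
  column of strip \<open>n\<close> for smaller times.
\<close>

primrec access_path :: "nat \<Rightarrow> real \<Rightarrow> real ^ 2" where
  "access_path 0 r = H 0 (\<pi> 0 x, 1)"
| "access_path (Suc n) r = (if r \<le> 1 / 2 ^ n
     then H n (\<pi> n x, y n + (1 - y n) * max 0 (2 ^ Suc n * r - 1)) else access_path n r)"

lemma access_path_start:
  assumes "r \<le> 1 / 2 ^ n"
  shows "access_path n r = H n (\<pi> n x, 1)"
proof (cases n)
  case (Suc k)
  have "1 / 2 ^ Suc k \<le> (1 / 2 ^ k :: real)" by (simp add: field_simps)
  then have "r \<le> 1 / 2 ^ k" using assms unfolding Suc by (rule order_trans[rotated])
  moreover have "2 ^ Suc k * r \<le> 1" using assms unfolding Suc by (simp add: pos_le_divide_eq mult.commute)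
  ultimately show ?thesis using H_base[of k] Suc by simp
qed simp

lemma access_path_height:
  assumes "r \<le> 1 / 2 ^ n"
  shows "y n + (1 - y n) * max 0 (2 ^ Suc n * r - 1) \<in> {0..1}"
proof -
  have "max 0 (2 ^ Suc n * r - 1) \<le> 1" using assms by (simp add: field_simps)
  then have "(1 - y n) * max 0 (2 ^ Suc n * r - 1) \<le> 1 - y n"
    using y_range[of n] by (intro mult_left_le) auto
  moreover have "0 \<le> (1 - y n) * max 0 (2 ^ Suc n * r - 1)" using y_range[of n] by simp
  ultimately show ?thesis using y_range[of n] by (simp only: atLeastAtMost_iff) linarith
qed

lemma access_path_cont: "continuous_on {0..1} (access_path n)"
proof (induction n)
  case (Suc n)
  have "continuous_on {0..1} (\<lambda>r. if r \<le> 1 / 2 ^ n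
     then H n (\<pi> n x, y n + (1 - y n) * max 0 (2 ^ Suc n * r - 1)) else access_path n r)"
  proof (rule continuous_on_cases_le)
    show "continuous_on {r \<in> {0..1}. r \<le> 1 / 2 ^ n} (\<lambda>r. H n (\<pi> n x, y n + (1 - y n) * max 0 (2 ^ Suc n * r - 1)))"
      by (rule continuous_on_compose2[OF H_cont])
         (use access_path_height proj_in[OF x_in] in \<open>auto intro!: continuous_intros\<close>)
    show "continuous_on {r \<in> {0..1}. 1 / 2 ^ n \<le> r} (access_path n)"
      by (rule continuous_on_subset[OF Suc]) auto
  qed (auto simp: access_path_start intro!: continuous_intros)
  moreover have "access_path (Suc n) = (\<lambda>r. if r \<le> 1 / 2 ^ n
     then H n (\<pi> n x, y n + (1 - y n) * max 0 (2 ^ Suc n * r - 1)) else access_path n r)"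
    by (rule ext) (simp only: access_path.simps)
  ultimately show ?case by (simp only:)
qed simp

lemma access_path_step: "dist (access_path (Suc (Suc n)) r) (access_path (Suc n) r) \<le> 2 * \<eta> n"
proof (cases "r \<le> 1 / 2 ^ Suc n")
  case True
  define s where "s = y (Suc n) + (1 - y (Suc n)) * max 0 (2 ^ Suc (Suc n) * r - 1)"
  have "s \<in> {0..1}" unfolding s_def by (rule access_path_height[OF True])
  moreover have "access_path (Suc (Suc n)) r = H (Suc n) (\<pi> (Suc n) x, s)"
    using True by (simp add: s_def)
  moreover have "access_path (Suc n) r = H (Suc n) (\<pi> (Suc n) x, 1)"
    by (rule access_path_start[OF True])
  ultimately show ?thesis
    using column_near_core[OF x_in, of s n] column_near_core[OF x_in, of 1 n]
      dist_triangle2[of "H (Suc n) (\<pi> (Suc n) x, s)" "H (Suc n) (\<pi> (Suc n) x, 1)" "H n (\<pi> n x, 0)"]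
    by simp
next
  case False
  then show ?thesis using \<eta>_pos[of n] by (simp add: less_imp_le)
qed

lemma access_path_stable:
  assumes "1 / 2 ^ n < r" "n \<le> m"
  shows "access_path m r = access_path n r"
  using assms(2)
proof (induction m rule: dec_induct)
  case (step m)
  have "1 / 2 ^ m \<le> (1 / 2 ^ n :: real)" using step by (simp add: field_simps)
  then show ?case using step assms(1) by simp
qed simp

text \<open>
  A point of the limit path at positive time lies in strip \<open>n\<close> but not in strip
  \<open>n + 1\<close>, for the \<open>n\<close> given by its dyadic level. So the level can be read off from
  the point, which gives injectivity, and the point is not in the limit set, which is contained in every
  strip.
\<close>

lemma access_arc: "accessible_point (\<nu> ` X) (\<nu> x)"
proof -
  have half: "2 * \<eta> (Suc n) \<le> 2 * \<eta> n / 2" for n using \<eta>_half[of n] by simp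
  obtain \<alpha> where \<alpha>: "continuous_on {0..1} \<alpha>"
    and "\<And>n r. r \<in> {0..1} \<Longrightarrow> dist (\<alpha> r) (access_path (Suc n) r) \<le> 2 * (2 * \<eta> n)"
    and lim: "\<And>r. r \<in> {0..1} \<Longrightarrow> (\<lambda>n. access_path (Suc n) r) \<longlonglongrightarrow> \<alpha> r"
    by (rule halving_limit[of "{0..1}" "\<lambda>n. access_path (Suc n)" "\<lambda>n. 2 * \<eta> n", OF access_path_cont access_path_step half]) (rule that)
  have \<alpha>_zero: "\<alpha> 0 = \<nu> x"
  proof (rule LIMSEQ_unique[OF lim])
    have "(\<lambda>n. H (Suc n) (\<pi> (Suc n) x, 1) - H n (\<pi> n x, 0)) \<longlonglongrightarrow> 0"
      by (rule Lim_null_comparison[OF _ \<eta>_tendsto])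
         (use column_near_core[OF x_in, of 1] in \<open>simp add: dist_norm\<close>)
    then have "(\<lambda>n. H (Suc n) (\<pi> (Suc n) x, 1)) \<longlonglongrightarrow> \<nu> x"
      by (rule Lim_transform[OF core_tendsto[OF x_in]])
    moreover have "access_path (Suc n) 0 = H (Suc n) (\<pi> (Suc n) x, 1)" for n
      by (rule access_path_start) simp
    ultimately show "(\<lambda>n. access_path (Suc n) 0) \<longlonglongrightarrow> \<nu> x"
      by simp
  qed simp
  have \<alpha>_pos: "\<exists>n. 1 / 2 ^ Suc n < r \<and> r \<le> 1 / 2 ^ n" if r: "0 < r" "r \<le> 1" for r :: real
  proof -
    obtain k where "(1 / 2) ^ k < r"
      using real_arch_pow_inv[of r "1 / 2"] r by auto
    then have "1 / 2 ^ k < r" by (simp add: power_one_over)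
    moreover have "1 / 2 ^ Suc k \<le> (1 / 2 ^ k :: real)" by (simp add: field_simps)
    ultimately have "\<exists>n. 1 / 2 ^ Suc n < r" by (metis le_less_trans)
    then obtain n where n: "1 / 2 ^ Suc n < r" "\<And>k. k < n \<Longrightarrow> \<not> 1 / 2 ^ Suc k < r"
      using exists_least_iff[of "\<lambda>n. 1 / 2 ^ Suc n < r"] by blast
    have "r \<le> 1 / 2 ^ n"
    proof (cases n)
      case (Suc k)
      then show ?thesis using n(2)[of k] by (simp only: not_less lessI)
    qed (use r in simp)
    then show ?thesis using n(1) by blast
  qed
  have \<alpha>_eq: "\<alpha> r = H n (\<pi> n x, y n + (1 - y n) * (2 ^ Suc n * r - 1))"
    if "1 / 2 ^ Suc n < r" "r \<le> 1 / 2 ^ n" for n r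
  proof -
    have "r \<le> 1" using that(2) by (rule order_trans) simp
    moreover have "0 < r" using that(1) by (rule less_trans[rotated]) simp
    moreover have "(\<lambda>m. access_path (Suc m) r) \<longlonglongrightarrow> access_path (Suc n) r"
      by (rule tendsto_eventually, rule eventually_sequentiallyI[of n], rule access_path_stable[OF that(1)]) simp
    ultimately have "\<alpha> r = access_path (Suc n) r"
      using LIMSEQ_unique[OF lim] by auto
    moreover have "0 \<le> 2 ^ Suc n * r - 1" using that(1) by (simp add: field_simps)
    ultimately show ?thesis using that by (simp add: max_absorb2)
  qed
  have height: "y n < y n + (1 - y n) * (2 ^ Suc n * r - 1) \<and> y n + (1 - y n) * (2 ^ Suc n * r - 1) \<le> 1"
    if "1 / 2 ^ Suc n < r" "r \<le> 1 / 2 ^ n" for n r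
  proof -
    have "0 < 2 ^ Suc n * r - 1" "2 ^ Suc n * r - 1 \<le> 1" using that by (simp_all add: field_simps)
    then have "0 < (1 - y n) * (2 ^ Suc n * r - 1)" "(1 - y n) * (2 ^ Suc n * r - 1) \<le> 1 - y n"
      using y_range[of n] by (simp, intro mult_left_le) auto
    then show ?thesis by linarith
  qed
  have \<alpha>_level: "\<alpha> r \<in> H n ` strip" "\<alpha> r \<notin> H (Suc n) ` strip"
    if r: "1 / 2 ^ Suc n < r" "r \<le> 1 / 2 ^ n" for n r
    using height[OF r] y_range[of n] proj_in[OF x_in, of n] H_free[of n] by (auto simp: \<alpha>_eq[OF r])
  have \<alpha>_free: "\<alpha> r \<notin> \<nu> ` X" if r: "0 < r" "r \<le> 1" for r
  proof -
    obtain n where "\<alpha> r \<notin> H (Suc n) ` strip" using \<alpha>_pos[OF r] \<alpha>_level(2) by metis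
    then show ?thesis using limit_in_strip[of _ "Suc n"] by auto
  qed
  have level_unique: "n = n'"
    if "1 / 2 ^ Suc n < r" "r \<le> 1 / 2 ^ n" "1 / 2 ^ Suc n' < r'" "r' \<le> 1 / 2 ^ n'" "\<alpha> r = \<alpha> r'" for n n' r r'
    using \<alpha>_level[OF that(1,2)] \<alpha>_level[OF that(3,4)] that(5) H_antimono[of "Suc n" n'] H_antimono[of "Suc n'" n]
    by (cases n n' rule: linorder_cases) auto
  have "inj_on \<alpha> {0..1}"
  proof (rule inj_onI)
    fix r r' :: real assume r: "r \<in> {0..1}" "r' \<in> {0..1}" and eq: "\<alpha> r = \<alpha> r'"
    have zero: "r = 0 \<longleftrightarrow> r' = 0"
      using \<alpha>_free[of r] \<alpha>_free[of r'] \<alpha>_zero eq x_in r by (metis atLeastAtMost_iff imageI le_less)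
    show "r = r'"
    proof (cases "r = 0")
      case False
      then obtain n n' where n: "1 / 2 ^ Suc n < r" "r \<le> 1 / 2 ^ n" "1 / 2 ^ Suc n' < r'" "r' \<le> 1 / 2 ^ n'"
        using \<alpha>_pos[of r] \<alpha>_pos[of r'] zero r by (metis atLeastAtMost_iff le_less)
      then have [simp]: "n' = n" using level_unique eq by blast
      have n': "1 / 2 ^ Suc n < r'" "r' \<le> 1 / 2 ^ n" using n by simp_all
      have "(\<pi> n x, y n + (1 - y n) * (2 ^ Suc n * r - 1)) = (\<pi> n x, y n + (1 - y n) * (2 ^ Suc n * r' - 1))"
        using eq height[OF n(1,2)] height[OF n'] y_range[of n] proj_in[OF x_in, of n]
        by (intro inj_onD[OF H_inj[of n]]) (auto simp: \<alpha>_eq[OF n(1,2)] \<alpha>_eq[OF n'])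
      then show ?thesis using y_range[of n] by simp
    qed (use zero in simp)
  qed
  then obtain \<beta> where "homeomorphism {0..1} (\<alpha> ` {0..1}) \<alpha> \<beta>"
    using homeomorphism_compact[OF compact_Icc \<alpha> refl] by blast
  then have "\<alpha> ` {0..1} homeomorphic {0..1::real}"
    using homeomorphic_def homeomorphic_sym by blast
  moreover have "\<alpha> ` {0..1} \<inter> \<nu> ` X = {\<nu> x}"
  proof -
    have "\<alpha> r = \<nu> x" if "r \<in> {0..1}" "\<alpha> r \<in> \<nu> ` X" for r
      using \<alpha>_free[of r] that \<alpha>_zero by (cases "r = 0") auto
    moreover have "\<nu> x \<in> \<alpha> ` {0..1}" using \<alpha>_zero by (metis atLeastAtMost_iff imageI order_refl zero_le_one)
    ultimately show ?thesis using x_in by blast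
  qed
  ultimately show ?thesis using x_in by (auto simp: accessible_point_def)
qed

end

theorem (in projection_system) one_sided_system_embedding:
  "\<exists>\<nu>. thin_planar_embedding X \<nu> \<and> accessible_point (\<nu> ` X) (\<nu> x)"
proof -
  obtain H \<eta> y where "strip_tower X \<pi> g x H \<eta> y" using tower_exists by blast
  then interpret strip_tower X \<pi> g x H \<eta> y .
  obtain \<nu> where "continuous_on X \<nu>" "\<And>n \<xi>. \<xi> \<in> X \<Longrightarrow> dist (\<nu> \<xi>) (H n (\<pi> n \<xi>, 0)) \<le> 2 * \<eta> n"
    using limit_map_exists by blast
  then interpret strip_tower_limit X \<pi> g x H \<eta> y \<nu>
    by unfold_locales
  show ?thesis using limit_thin access_arc by blast
qed

section \<open>Factoring bonding maps into one-sided maps\<close>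

lemma one_sided_at_reflect:
  assumes "one_sided_at f (1 - p)"
  shows "one_sided_at (\<lambda>t. f (1 - t)) p"
proof -
  have "t \<in> {p..1} \<longleftrightarrow> 1 - t \<in> {0..1 - p}" "t \<in> {0..p} \<longleftrightarrow> 1 - t \<in> {1 - p..1}" for t :: real
    by auto
  then show ?thesis using assms unfolding one_sided_at_def by blast
qed

text \<open>
  Suppose that \<open>S\<close> reaches the top of the interval at \<open>y\<close> without dropping below its
  base value on the way from \<open>q\<close>. Then everything \<open>S\<close> does beyond \<open>y\<close>
  can be postponed: \<open>h\<close> follows \<open>S\<close> (scaled by one half) up to \<open>y\<close> and
  then escapes straight into the upper half of the interval, so it stays above its base value to the right of
  \<open>q\<close>; \<open>g\<close> undoes the scaling on the lower half, hence is increasing below the base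
  point, and replays the rest of \<open>S\<close> on the upper half.
\<close>

lemma factor_right:
  assumes cont: "continuous_on {0..1} S" and maps: "S ` {0..1} \<subseteq> {0..1}"
    and q: "q \<in> {0..1}" and y: "y \<in> {0..1}" and top: "S y = 1" and "q \<le> y"
    and above: "\<And>t. t \<in> {q..y} \<Longrightarrow> S q \<le> S t"
  obtains g h where "continuous_on {0..1} g" "g ` {0..1} \<subseteq> {0..1}"
    "continuous_on {0..1} h" "h ` {0..1} \<subseteq> {0..1}" "\<And>t. t \<in> {0..1} \<Longrightarrow> g (h t) = S t"
    "one_sided_at h q" "one_sided_at g (h q)"
proof -
  define h where "h t = (if t \<le> y then S t / 2 else (1 + t - y) / 2)" for t
  define g where "g z = (if z \<le> 1 / 2 then 2 * z else S (min 1 (y + 2 * z - 1)))" for z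
  have S01: "0 \<le> S t" "S t \<le> 1" if "t \<in> {0..1}" for t
    using maps that by (auto simp: image_subset_iff)
  have "continuous_on {0..1} h"
    unfolding h_def using y top
    by (intro continuous_on_cases_le continuous_intros continuous_on_subset[OF cont]) auto
  moreover have "continuous_on {0..1} g"
    unfolding g_def
  proof (rule continuous_on_cases_le)
    show "2 * z = S (min 1 (y + 2 * z - 1))" if "z = 1 / 2" for z
      using y top by (simp add: \<open>z = 1 / 2\<close>)
    show "continuous_on {z \<in> {0..1}. 1 / 2 \<le> z} (\<lambda>z. S (min 1 (y + 2 * z - 1)))"
      using y by (intro continuous_intros continuous_on_compose2[OF cont]) auto
  qed (intro continuous_intros)+
  moreover have "h t \<in> {0..1}" if "t \<in> {0..1}" for t
    using S01[OF that] that y by (auto simp: h_def)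
  moreover have "g z \<in> {0..1}" if "z \<in> {0..1}" for z
    using S01[of "min 1 (y + 2 * z - 1)"] that y by (auto simp: g_def)
  moreover have "g (h t) = S t" if "t \<in> {0..1}" for t
  proof (cases "t \<le> y")
    case False
    have "y + 2 * ((1 + t - y) / 2) - 1 = t" by (simp add: field_simps)
    then show ?thesis using False that by (simp add: g_def h_def del: times_divide_eq_right)
  qed (use S01[OF that] in \<open>simp add: g_def h_def\<close>)
  moreover have "one_sided_at h q"
    unfolding one_sided_at_def using above S01[OF q] \<open>q \<le> y\<close> by (auto simp: h_def)
  moreover have "one_sided_at g (h q)"
    unfolding one_sided_at_def using S01[OF q] \<open>q \<le> y\<close> by (auto simp: g_def h_def)
  ultimately show thesis using that[of g h] by blast
qed

lemma factor_one_sided: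
  assumes cont: "continuous_on {0..1} S" and maps: "S ` {0..1} \<subseteq> {0..1}"
    and q: "q \<in> {0..1}" and y: "y \<in> {0..1}" and top: "S y = 1"
    and above: "\<And>t. t \<in> closed_segment q y \<Longrightarrow> S q \<le> S t"
  shows "\<exists>g h. continuous_on {0..1} g \<and> g ` {0..1} \<subseteq> {0..1} \<and>
    continuous_on {0..1} h \<and> h ` {0..1} \<subseteq> {0..1} \<and> (\<forall>t\<in>{0..1}. g (h t) = S t) \<and>
    one_sided_at h q \<and> one_sided_at g (h q)"
proof (cases "q \<le> y")
  case True
  have "S q \<le> S t" if "t \<in> {q..y}" for t
    using above[of t] True that by (simp add: closed_segment_eq_real_ivl)
  then show ?thesis
    by (rule factor_right[OF cont maps q y top True]) blast+
next
  case False
  define S' where "S' t = S (1 - t)" for t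
  have cont': "continuous_on {0..1} S'"
    unfolding S'_def by (intro continuous_on_compose2[OF cont] continuous_intros) auto
  have maps': "S' ` {0..1} \<subseteq> {0..1}"
    using maps by (auto simp: S'_def image_subset_iff)
  obtain g h where gh: "continuous_on {0..1} g" "g ` {0..1} \<subseteq> {0..1}"
    "continuous_on {0..1} h" "h ` {0..1} \<subseteq> {0..1}" "\<And>t. t \<in> {0..1} \<Longrightarrow> g (h t) = S' t"
    "one_sided_at h (1 - q)" "one_sided_at g (h (1 - q))"
    by (rule factor_right[OF cont' maps', of "1 - q" "1 - y"])
       (use q y top above False in \<open>auto simp: S'_def closed_segment_eq_real_ivl\<close>)
  have "continuous_on {0..1} (\<lambda>t. h (1 - t))"
    by (intro continuous_on_compose2[OF gh(3)] continuous_intros) auto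
  moreover have "(\<lambda>t. h (1 - t)) ` {0..1} \<subseteq> {0..1}"
    using gh(4) by (auto simp: image_subset_iff)
  moreover have "g (h (1 - t)) = S t" if "t \<in> {0..1}" for t
    using gh(5)[of "1 - t"] that by (simp add: S'_def)
  ultimately show ?thesis
    using gh(1,2,7) one_sided_at_reflect[OF gh(6)] by blast
qed

text \<open>
  The bonding map \<open>\<phi> n\<close> sweeps over the whole interval between \<open>w\<^sub>0 n\<close>
  and \<open>w\<^sub>1 n\<close>, both above the base point. The second of these points is in turn reached by
  \<open>\<phi> (Suc n)\<close> along a segment that starts at the next base point, on either side of it, and
  that \<open>\<phi> (Suc n)\<close> keeps above the base value. The last assumption says that this segment
  does not extend beyond the start \<open>w\<^sub>0 (Suc n)\<close> of the next sweep.
\<close>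

locale spread_system =
  fixes X :: "'a::topological_space set" and \<zeta> :: "nat \<Rightarrow> 'a \<Rightarrow> real"
    and \<phi> :: "nat \<Rightarrow> real \<Rightarrow> real" and x :: 'a and w\<^sub>0 w\<^sub>1 c y :: "nat \<Rightarrow> real"
  assumes compact_X: "compact X" and x_in: "x \<in> X"
    and \<zeta>_cont: "continuous_on X (\<zeta> n)"
    and \<zeta>_in: "\<xi> \<in> X \<Longrightarrow> \<zeta> n \<xi> \<in> {0..1}"
    and \<phi>_cont: "continuous_on {0..1} (\<phi> n)"
    and \<phi>_maps: "\<phi> n ` {0..1} \<subseteq> {0..1}"
    and \<phi>_\<zeta>: "\<xi> \<in> X \<Longrightarrow> \<phi> n (\<zeta> (Suc n) \<xi>) = \<zeta> n \<xi>"
    and \<zeta>_separate: "\<xi> \<in> X \<Longrightarrow> \<xi>' \<in> X \<Longrightarrow> (\<And>n. \<zeta> n \<xi> = \<zeta> n \<xi>') \<Longrightarrow> \<xi> = \<xi>'"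
    and w_order: "\<zeta> (Suc n) x < w\<^sub>0 n" "w\<^sub>0 n < w\<^sub>1 n" "w\<^sub>1 n \<le> 1"
    and c: "c n \<in> {0, 1}"
    and \<phi>_w: "\<phi> n (w\<^sub>0 n) = c n" "\<phi> n (w\<^sub>1 n) = 1 - c n"
    and y_in: "y n \<in> {0..1}"
    and \<phi>_y: "\<phi> (Suc n) (y n) = w\<^sub>1 n"
    and y_above: "t \<in> closed_segment (\<zeta> (Suc (Suc n)) x) (y n) \<Longrightarrow> \<zeta> (Suc n) x \<le> \<phi> (Suc n) t"
    and y_le: "y n \<le> w\<^sub>0 (Suc n)"
begin

text \<open>
  The maps \<open>unfold n\<close> and \<open>refold n\<close> factor \<open>\<phi> n\<close>. From
  \<open>w\<^sub>0 n\<close> on, where \<open>\<phi> n\<close> has an extreme value, the intermediate interval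
  only records the value of \<open>\<phi> n\<close>, as the position on a single leg
  \<open>[w\<^sub>0 n, 1]\<close> that \<open>refold n\<close> maps monotonically onto the whole interval. The
  gain is that \<open>unfold n\<close> reaches the end 1 of its range already at \<open>w\<^sub>1 n\<close>.
\<close>

definition unfold :: "nat \<Rightarrow> real \<Rightarrow> real" where
  "unfold n w = (if w \<le> w\<^sub>0 n then w else w\<^sub>0 n + (1 - w\<^sub>0 n) * \<bar>\<phi> n w - c n\<bar>)"

definition refold :: "nat \<Rightarrow> real \<Rightarrow> real" where
  "refold n u = (if u \<le> w\<^sub>0 n then \<phi> n u else \<bar>(u - w\<^sub>0 n) / (1 - w\<^sub>0 n) - c n\<bar>)"

lemma w\<^sub>0_range: "0 \<le> w\<^sub>0 n" "w\<^sub>0 n < 1"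
  using \<zeta>_in[OF x_in, of "Suc n"] w_order[of n] by auto

lemma \<phi>_range:
  assumes "t \<in> {0..1}"
  shows "0 \<le> \<phi> n t" "\<phi> n t \<le> 1"
  using \<phi>_maps[of n] assms by (auto simp: image_subset_iff)

lemma unfold_leg:
  assumes "t \<in> {0..1}" "w\<^sub>0 n < t"
  shows "w\<^sub>0 n \<le> unfold n t" "unfold n t \<le> 1"
proof -
  have "(1 - w\<^sub>0 n) * \<bar>\<phi> n t - c n\<bar> \<le> 1 - w\<^sub>0 n"
    using \<phi>_range[OF assms(1), of n] c[of n] w\<^sub>0_range[of n] by (intro mult_left_le) auto
  moreover have "0 \<le> (1 - w\<^sub>0 n) * \<bar>\<phi> n t - c n\<bar>"
    using w\<^sub>0_range[of n] by simp
  ultimately show "w\<^sub>0 n \<le> unfold n t" "unfold n t \<le> 1"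
    using assms(2) unfolding unfold_def by (simp_all only: not_le[symmetric] if_False)
qed

lemma unfold_in:
  assumes "t \<in> {0..1}"
  shows "unfold n t \<in> {0..1}"
  using unfold_leg[OF assms, of n] w\<^sub>0_range[of n] assms
  by (cases "t \<le> w\<^sub>0 n") (auto simp: unfold_def)

lemma unfold_cont: "continuous_on {0..1} (unfold n)"
  unfolding unfold_def using \<phi>_w[of n]
  by (intro continuous_on_cases_le continuous_intros continuous_on_subset[OF \<phi>_cont]) auto

lemma refold_in: "u \<in> {0..1} \<Longrightarrow> refold n u \<in> {0..1}"
  using \<phi>_range[of u n] c[of n] w\<^sub>0_range[of n] by (auto simp: refold_def field_simps abs_if)

lemma refold_cont: "continuous_on {0..1} (refold n)"
  unfolding refold_def using \<phi>_w(1)[of n] w\<^sub>0_range[of n] c[of n]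
  by (intro continuous_on_cases_le continuous_intros continuous_on_subset[OF \<phi>_cont]) auto

lemma refold_unfold:
  assumes "t \<in> {0..1}"
  shows "refold n (unfold n t) = \<phi> n t"
proof -
  define d where "d = \<bar>\<phi> n t - c n\<bar>"
  have "\<bar>d - c n\<bar> = \<phi> n t"
    using \<phi>_range[OF assms, of n] c[of n] by (auto simp: d_def)
  moreover have "0 < (1 - w\<^sub>0 n) * d" if "d \<noteq> 0"
    using that w\<^sub>0_range[of n] by (simp add: d_def)
  ultimately show ?thesis
    using w\<^sub>0_range[of n] \<phi>_w(1)[of n] c[of n]
    by (cases "d = 0") (auto simp: unfold_def refold_def d_def[symmetric])
qed

lemma unfold_base: "unfold n (\<zeta> (Suc n) x) = \<zeta> (Suc n) x"
  using w_order[of n] by (simp add: unfold_def)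

lemma unfold_above:
  assumes "\<zeta> (Suc n) x \<le> t" "t \<le> 1"
  shows "\<zeta> (Suc n) x \<le> unfold n t"
proof -
  have "t \<in> {0..1}" using assms \<zeta>_in[OF x_in, of "Suc n"] by auto
  then show ?thesis
    using assms unfold_leg(1)[of t n] w_order[of n]
    by (cases "t \<le> w\<^sub>0 n") (simp add: unfold_def, linarith)
qed

lemma unfold_w\<^sub>1: "unfold n (w\<^sub>1 n) = 1"
  using w_order[of n] \<phi>_w(2)[of n] c[of n] by (auto simp: unfold_def)

text \<open>
  Composed in the other order, \<open>unfold n\<close> after \<open>refold (Suc n)\<close>, these maps meet
  the hypothesis of the factorization: along the segment to \<open>y n\<close> the map
  \<open>refold (Suc n)\<close> agrees with \<open>\<phi> (Suc n)\<close>, stays above the base value and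
  arrives at \<open>w\<^sub>1 n\<close>, where \<open>unfold n\<close> equals 1.
\<close>

lemma bond_factors:
  "\<exists>g h. continuous_on {0..1} g \<and> g ` {0..1} \<subseteq> {0..1} \<and>
    continuous_on {0..1} h \<and> h ` {0..1} \<subseteq> {0..1} \<and>
    (\<forall>t\<in>{0..1}. g (h t) = unfold n (refold (Suc n) t)) \<and>
    one_sided_at h (\<zeta> (Suc (Suc n)) x) \<and> one_sided_at g (h (\<zeta> (Suc (Suc n)) x))"
proof (rule factor_one_sided[of "\<lambda>t. unfold n (refold (Suc n) t)" _ "y n"])
  let ?q = "\<zeta> (Suc (Suc n)) x"
  show "continuous_on {0..1} (\<lambda>t. unfold n (refold (Suc n) t))"
    by (rule continuous_on_compose2[OF unfold_cont refold_cont]) (use refold_in in blast)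
  show "(\<lambda>t. unfold n (refold (Suc n) t)) ` {0..1} \<subseteq> {0..1}"
    using refold_in unfold_in by blast
  show "?q \<in> {0..1}" by (rule \<zeta>_in[OF x_in])
  show "y n \<in> {0..1}" by (rule y_in)
  show "unfold n (refold (Suc n) (y n)) = 1"
    using y_le[of n] by (simp add: refold_def \<phi>_y unfold_w\<^sub>1)
  fix t assume t: "t \<in> closed_segment ?q (y n)"
  have "t \<le> w\<^sub>0 (Suc n)" "t \<in> {0..1}"
    using t y_le[of n] w_order(1)[of "Suc n"] y_in[of n] \<zeta>_in[OF x_in, of "Suc (Suc n)"]
    by (auto simp: closed_segment_eq_real_ivl split: if_splits)
  then show "unfold n (refold (Suc n) ?q) \<le> unfold n (refold (Suc n) t)"
    using w_order(1)[of "Suc n"] unfold_above[OF y_above[OF t]] \<phi>_range(2)[of t "Suc n"]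
    by (simp add: refold_def \<phi>_\<zeta>[OF x_in] unfold_base)
qed

text \<open>
  The even coordinates run through the intermediate intervals of \<open>unfold\<close>, the odd ones through
  the intervals supplied by the factorization. They still separate points because \<open>refold\<close>
  recovers \<open>\<zeta>\<close>.
\<close>

theorem spread_system_embedding:
  "\<exists>\<nu>. thin_planar_embedding X \<nu> \<and> accessible_point (\<nu> ` X) (\<nu> x)"
proof -
  obtain g h where gh: "\<And>n. continuous_on {0..1} (g n)" "\<And>n. g n ` {0..1} \<subseteq> {0..1}"
    "\<And>n. continuous_on {0..1} (h n)" "\<And>n. h n ` {0..1} \<subseteq> {0..1}"
    and factor: "\<And>n t. t \<in> {0..1} \<Longrightarrow> g n (h n t) = unfold n (refold (Suc n) t)"
    and os: "\<And>n. one_sided_at (h n) (\<zeta> (Suc (Suc n)) x)" "\<And>n. one_sided_at (g n) (h n (\<zeta> (Suc (Suc n)) x))"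
    using bond_factors by metis
  define \<sigma> where "\<sigma> n \<xi> = unfold n (\<zeta> (Suc n) \<xi>)" for n \<xi>
  define \<pi> where "\<pi> k \<xi> = (if even k then \<sigma> (k div 2) \<xi> else h (k div 2) (\<sigma> (Suc (k div 2)) \<xi>))" for k \<xi>
  define G where "G k = (if even k then g (k div 2) else h (k div 2))" for k
  have \<sigma>_in: "\<sigma> n \<xi> \<in> {0..1}" if "\<xi> \<in> X" for n \<xi>
    unfolding \<sigma>_def by (rule unfold_in[OF \<zeta>_in[OF that]])
  have \<sigma>_cont: "continuous_on X (\<sigma> n)" for n
    unfolding \<sigma>_def by (rule continuous_on_compose2[OF unfold_cont \<zeta>_cont]) (use \<zeta>_in in blast)
  have \<sigma>_base: "\<sigma> n x = \<zeta> (Suc n) x" for n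
    by (simp add: \<sigma>_def unfold_base)
  have refold_\<sigma>: "refold n (\<sigma> n \<xi>) = \<zeta> n \<xi>" if "\<xi> \<in> X" for n \<xi>
    by (simp add: \<sigma>_def refold_unfold[OF \<zeta>_in[OF that]] \<phi>_\<zeta>[OF that])
  have "projection_system X \<pi> G x"
  proof
    show "compact X" "x \<in> X" by (fact compact_X x_in)+
    show "continuous_on X (\<pi> k)" for k
      using \<sigma>_cont continuous_on_compose2[OF gh(3) \<sigma>_cont] \<sigma>_in
      by (cases "even k") (auto simp: \<pi>_def[abs_def] image_subset_iff)
    show "\<pi> k \<xi> \<in> {0..1}" if "\<xi> \<in> X" for k \<xi>
      using \<sigma>_in[OF that] gh(4) unfolding \<pi>_def image_subset_iff by presburger
    show "continuous_on {0..1} (G k)" "G k ` {0..1} \<subseteq> {0..1}" for k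
      using gh by (auto simp: G_def)
    show "G k (\<pi> (Suc k) \<xi>) = \<pi> k \<xi>" if "\<xi> \<in> X" for k \<xi>
      using factor[OF \<sigma>_in[OF that]] refold_\<sigma>[OF that]
      by (auto simp: G_def \<pi>_def \<sigma>_def[symmetric])
    show "\<xi> = \<xi>'" if \<xi>: "\<xi> \<in> X" "\<xi>' \<in> X" and eq: "\<And>k. \<pi> k \<xi> = \<pi> k \<xi>'" for \<xi> \<xi>'
    proof (rule \<zeta>_separate[OF \<xi>])
      fix n
      have "\<sigma> n \<xi> = \<sigma> n \<xi>'" using eq[of "2 * n"] by (simp add: \<pi>_def)
      then show "\<zeta> n \<xi> = \<zeta> n \<xi>'" using refold_\<sigma> \<xi> by metis
    qed
    show "one_sided_at (G k) (\<pi> (Suc k) x)" for k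
      using os by (auto simp: G_def \<pi>_def \<sigma>_base)
  qed
  then show ?thesis by (rule projection_system.one_sided_system_embedding)
qed

end

section \<open>Gaps of the post-critical set\<close>

lemma continuous_on_funpow:
  assumes "continuous_on S f" "f ` S \<subseteq> S"
  shows "continuous_on S (f ^^ n)" "(f ^^ n) ` S \<subseteq> S"
proof (induction n)
  case (Suc n)
  { case 1 show ?case
      using continuous_on_compose[OF Suc(1) continuous_on_subset[OF assms(1) Suc(2)]] by simp }
  { case 2 show ?case using Suc(2) assms(2) by (force simp: image_subset_iff) }
qed simp_all

text \<open>
  For a post-critically finite map, \<open>P\<close> is the union of the orbits of the critical points.
\<close>

locale markov_partition =
  fixes f :: "real \<Rightarrow> real" and P :: "real set"
  assumes f_cont: "continuous_on {0..1} f" and f_maps: "f ` {0..1} \<subseteq> {0..1}"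
    and P_finite: "finite P" and ends_in_P: "0 \<in> P" "1 \<in> P" and P_sub: "P \<subseteq> {0..1}"
    and P_invariant: "f ` P \<subseteq> P"
    and f_inj: "0 \<le> a \<Longrightarrow> a < b \<Longrightarrow> b \<le> 1 \<Longrightarrow> {a<..<b} \<inter> P = {} \<Longrightarrow> inj_on f {a..b}"
begin

definition gap :: "real \<Rightarrow> real \<Rightarrow> bool" where
  "gap a b \<longleftrightarrow> a \<in> P \<and> b \<in> P \<and> a < b \<and> {a<..<b} \<inter> P = {}"

lemma iterate_cont: "continuous_on {0..1} (f ^^ n)" and iterate_maps: "(f ^^ n) ` {0..1} \<subseteq> {0..1}"
  using continuous_on_funpow[OF f_cont f_maps] by blast+

lemma gap_in: "gap a b \<Longrightarrow> 0 \<le> a \<and> a < b \<and> b \<le> 1"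
  using P_sub by (auto simp: gap_def)

lemma gap_between:
  assumes pq: "p \<in> P" "q \<in> P" "p < q" and z: "z \<in> {p..q}"
  obtains a b where "gap a b" "p \<le> a" "b \<le> q" "z \<in> {a..b}"
proof (cases "z = q")
  case True
  define a where "a = Max {r \<in> P. r < q}"
  have ne: "{r \<in> P. r < q} \<noteq> {}" using pq by blast
  have fin: "finite {r \<in> P. r < q}" using P_finite by simp
  have a: "a \<in> P" "a < q" using Max_in[OF fin ne] by (auto simp: a_def)
  have a_max: "r \<le> a" if "r \<in> P" "r < q" for r using Max_ge[OF fin] that by (simp add: a_def)
  have "gap a q" using a a_max pq by (force simp: gap_def)
  then show thesis using that[of a q] a a_max pq True by auto
next
  case False
  define a where "a = Max {r \<in> P. r \<le> z}"
  define b where "b = Min {r \<in> P. z < r}"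
  have fin: "finite {r \<in> P. r \<le> z}" "finite {r \<in> P. z < r}" using P_finite by simp_all
  have ne: "{r \<in> P. r \<le> z} \<noteq> {}" "{r \<in> P. z < r} \<noteq> {}" using pq z False by force+
  have a: "a \<in> P" "a \<le> z" using Max_in[OF fin(1) ne(1)] by (auto simp: a_def)
  have b: "b \<in> P" "z < b" using Min_in[OF fin(2) ne(2)] by (auto simp: b_def)
  have a_max: "r \<le> a" if "r \<in> P" "r \<le> z" for r using Max_ge[OF fin(1)] that by (simp add: a_def)
  have b_min: "b \<le> r" if "r \<in> P" "z < r" for r using Min_le[OF fin(2)] that by (simp add: b_def)
  have "gap a b" using a b a_max b_min by (force simp: gap_def)
  moreover have "p \<le> a" "b \<le> q" using a_max[of p] b_min[of q] pq z False by auto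
  ultimately show thesis using that a b by auto
qed

text \<open>
  Gaps pull back along iterates: \<open>f\<close> maps a gap injectively onto an interval with ends in
  \<open>P\<close>, and that interval is a union of gaps. A point in a closed gap therefore lies on a branch
  of the iterate that is carried injectively onto a full gap. The point may be an end of the branch, for
  instance when it belongs to \<open>P\<close>.
\<close>

lemma branch_onto_gap:
  assumes "gap \<alpha> \<beta>" "y \<in> {\<alpha>..\<beta>}"
  shows "\<exists>u v a b. y \<in> {u..v} \<and> {u..v} \<subseteq> {\<alpha>..\<beta>} \<and> inj_on (f ^^ n) {u..v} \<and>
    (f ^^ n) ` {u..v} = {a..b} \<and> gap a b"
proof (induction n)
  case 0
  show ?case using assms by (intro exI[of _ \<alpha>] exI[of _ \<beta>]) auto
next
  case (Suc n)
  then obtain u v a b where uv: "y \<in> {u..v}" "{u..v} \<subseteq> {\<alpha>..\<beta>}" and inj: "inj_on (f ^^ n) {u..v}"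
    and onto: "(f ^^ n) ` {u..v} = {a..b}" and ab: "gap a b"
    by blast
  let ?F = "f ^^ Suc n"
  have uv01: "{u..v} \<subseteq> {0..1}" using uv(2) gap_in[OF assms(1)] by auto
  have a_b: "0 \<le> a" "a < b" "b \<le> 1" using gap_in[OF ab] by auto
  have f_inj_ab: "inj_on f {a..b}" using f_inj[OF a_b] ab by (simp add: gap_def)
  have F_inj: "inj_on ?F {u..v}"
    using comp_inj_on[OF inj] f_inj_ab onto by simp
  have "f ` closed_segment a b = closed_segment (f a) (f b)"
    using a_b f_inj_ab continuous_on_subset[OF f_cont]
    by (intro continuous_injective_image_segment_1) (auto simp: closed_segment_eq_real_ivl)
  then have f_ab: "f ` {a..b} = closed_segment (f a) (f b)"
    using a_b by (simp add: closed_segment_eq_real_ivl)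
  define p where "p = min (f a) (f b)"
  define q where "q = max (f a) (f b)"
  have "f a \<noteq> f b" using inj_onD[OF f_inj_ab, of a b] a_b by auto
  then have "p < q" by (auto simp: p_def q_def)
  have "f a \<in> P" "f b \<in> P" using ab P_invariant by (auto simp: gap_def)
  then have "p \<in> P" "q \<in> P" by (auto simp: p_def q_def min_def max_def)
  have "f ` {a..b} = {p..q}"
    unfolding f_ab p_def q_def by (simp add: closed_segment_eq_real_ivl)
  note pq = \<open>p \<in> P\<close> \<open>q \<in> P\<close> \<open>p < q\<close> this
  have F_onto: "?F ` {u..v} = {p..q}" unfolding funpow.simps image_comp[symmetric] onto by (rule pq(4))
  then have "?F y \<in> {p..q}" using uv(1) by blast
  then obtain a' b' where gap': "gap a' b'" "p \<le> a'" "b' \<le> q" "?F y \<in> {a'..b'}"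
    by (rule gap_between[OF pq(1-3)])
  have "a' < b'" using gap_in[OF gap'(1)] by simp
  then have "a' \<in> ?F ` {u..v}" "b' \<in> ?F ` {u..v}" unfolding F_onto using gap' by auto
  then obtain u' v' where u': "u' \<in> {u..v}" "?F u' = a'" and v': "v' \<in> {u..v}" "?F v' = b'"
    by blast
  have seg: "closed_segment u' v' \<subseteq> {u..v}"
    using u' v' by (auto simp: closed_segment_eq_real_ivl split: if_splits)
  have F_seg: "?F ` closed_segment u' v' = {a'..b'}"
  proof -
    have "?F ` closed_segment u' v' = closed_segment (?F u') (?F v')"
      by (rule continuous_injective_image_segment_1[OF continuous_on_subset[OF iterate_cont order_trans[OF seg uv01]]
            inj_on_subset[OF F_inj seg]])
    then show ?thesis
      unfolding u'(2) v'(2) using \<open>a' < b'\<close> by (simp only: closed_segment_eq_real_ivl less_imp_le if_True)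
  qed
  have "y \<in> closed_segment u' v'"
  proof -
    obtain t where "t \<in> closed_segment u' v'" "?F t = ?F y" using F_seg gap'(4) by (metis imageE)
    then show ?thesis using inj_onD[OF F_inj] seg uv(1) by blast
  qed
  moreover have "closed_segment u' v' = {min u' v'..max u' v'}"
    by (simp add: closed_segment_eq_real_ivl)
  ultimately show ?case
    using F_seg order_trans[OF seg uv(2)] inj_on_subset[OF F_inj seg] gap'(1) by metis
qed

lemma branch_interior_avoids:
  assumes uv: "{u..v} \<subseteq> {0..1}" and inj: "inj_on (f ^^ n) {u..v}"
    and onto: "(f ^^ n) ` {u..v} = {a..b}" and gap: "gap a b" and t: "u < t" "t < v"
  shows "(f ^^ n) t \<notin> P"
proof
  assume "(f ^^ n) t \<in> P"
  moreover have "(f ^^ n) t \<in> {a..b}" using onto t by auto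
  ultimately have "(f ^^ n) t = a \<or> (f ^^ n) t = b"
    using gap unfolding gap_def disjoint_iff greaterThanLessThan_iff atLeastAtMost_iff
    by (metis order_le_less)
  moreover have "(f ^^ n) ` closed_segment u v = closed_segment ((f ^^ n) u) ((f ^^ n) v)"
    using t inj continuous_on_subset[OF iterate_cont uv]
    by (intro continuous_injective_image_segment_1) (auto simp: closed_segment_eq_real_ivl)
  then have "closed_segment ((f ^^ n) u) ((f ^^ n) v) = {a..b}"
    using t onto by (simp add: closed_segment_eq_real_ivl)
  then have "a = (f ^^ n) u \<or> a = (f ^^ n) v" "b = (f ^^ n) u \<or> b = (f ^^ n) v"
    using gap_in[OF gap] by (auto simp: closed_segment_eq_real_ivl Icc_eq_Icc split: if_splits)
  ultimately have "(f ^^ n) t = (f ^^ n) u \<or> (f ^^ n) t = (f ^^ n) v"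
    by auto
  then show False
    using inj_onD[OF inj, of t u] inj_onD[OF inj, of t v] t by auto
qed

text \<open>
  There are finitely many gaps, so a single iterate spreads both outer thirds of every gap over the whole
  interval.
\<close>

lemma outer_thirds_onto:
  assumes leo: "locally_eventually_onto f"
  obtains n where "1 \<le> n" "\<And>a b. gap a b \<Longrightarrow> (f ^^ n) ` {a..a + (b - a) / 3} = {0..1}"
    "\<And>a b. gap a b \<Longrightarrow> (f ^^ n) ` {b - (b - a) / 3..b} = {0..1}"
proof -
  have f_onto: "f ` {0..1} = {0..1}" using leo by (simp add: locally_eventually_onto_def)
  have onto: "(f ^^ n) ` {0..1} = {0..1}" for n
    by (induction n) (simp, simp only: funpow.simps image_comp[symmetric] f_onto)
  have later: "(f ^^ m) ` J = {0..1}" if "(f ^^ n) ` J = {0..1}" "n \<le> m" for m n J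
    using onto[of "m - n"] that by (metis funpow_add image_comp le_add_diff_inverse2)
  define G where "G = {(a, b). gap a b}"
  have "finite G"
    by (rule finite_subset[of _ "P \<times> P"]) (auto simp: G_def gap_def P_finite)
  define \<J> where "\<J> = (\<lambda>(a, b). {a..a + (b - a) / 3}) ` G \<union> (\<lambda>(a, b). {b - (b - a) / 3..b}) ` G"
  have "finite \<J>" using \<open>finite G\<close> by (simp add: \<J>_def)
  have "\<exists>n\<ge>1. (f ^^ n) ` J = {0..1}" if J: "J \<in> \<J>" for J
  proof -
    obtain a b where ab: "gap a b" and J: "J = {a..a + (b - a) / 3} \<or> J = {b - (b - a) / 3..b}"
      using J unfolding \<J>_def G_def by auto
    have "0 \<le> a" "a < b" "b \<le> 1" using gap_in[OF ab] by auto
    then have "0 \<le> a" "a < a + (b - a) / 3" "a + (b - a) / 3 \<le> 1"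
      "0 \<le> b - (b - a) / 3" "b - (b - a) / 3 < b" "b \<le> 1"
      by (simp_all add: field_simps)
    then obtain s t where st: "J = {s..t}" "0 \<le> s" "s < t" "t \<le> 1"
      using J by blast
    then have "is_interval J \<and> J \<subseteq> {0..1} \<and> (\<exists>a\<in>J. \<exists>b\<in>J. a < b)"
      using is_interval_cc[of s t] by (intro conjI bexI[of _ s] bexI[of _ t]) auto
    then show ?thesis using leo unfolding locally_eventually_onto_def by blast
  qed
  then obtain k where k: "\<And>J. J \<in> \<J> \<Longrightarrow> (f ^^ k J) ` J = {0..1}" by metis
  define n where "n = Max (insert 1 (k ` \<J>))"
  have n: "(f ^^ n) ` J = {0..1}" if "J \<in> \<J>" for J
    using \<open>finite \<J>\<close> that unfolding n_def by (intro later[OF k[OF that]] Max_ge) auto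
  have "1 \<le> n"
    using \<open>finite \<J>\<close> unfolding n_def by (intro Max_ge) auto
  moreover have "{a..a + (b - a) / 3} \<in> \<J>" "{b - (b - a) / 3..b} \<in> \<J>" if "gap a b" for a b
    using that unfolding \<J>_def G_def by (auto intro: rev_image_eqI)
  ultimately show thesis using that n by blast
qed

end

lemma post_critical_partition:
  assumes cont: "continuous_on {0..1} f" and maps: "f ` {0..1} \<subseteq> {0..1}"
    and pm: "piecewise_monotone f" and pcf: "post_critically_finite f"
  obtains P where "markov_partition f P"
proof -
  define P where "P = (\<Union>c\<in>critical_set f. range (\<lambda>i. (f ^^ i) c))"
  obtain m and c :: "nat \<Rightarrow> real" where c_ends: "c 0 = 0" "c (Suc m) = 1"
    and c_mono: "\<And>i. i \<le> m \<Longrightarrow> strict_mono_on {c i..c (Suc i)} f \<or> strict_antimono_on {c i..c (Suc i)} f"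
    and c_turn: "c ` {1..m} = turning_points f"
    using pm unfolding piecewise_monotone_def by blast
  have crit_sub: "critical_set f \<subseteq> {0..1}"
    by (auto simp: critical_set_def turning_points_def)
  have "finite (turning_points f)" unfolding c_turn[symmetric] by simp
  then have crit_fin: "finite (critical_set f)" by (simp add: critical_set_def)
  have crit_P: "critical_set f \<subseteq> P"
  proof
    show "r \<in> P" if "r \<in> critical_set f" for r
      unfolding P_def by (intro UN_I[OF that] range_eqI[of _ _ 0]) simp
  qed
  have orbit_fin: "finite (range (\<lambda>i. (f ^^ i) r))" if r: "r \<in> critical_set f" for r
  proof -
    obtain j k where jk: "1 \<le> j" "(f ^^ (j + k)) r = (f ^^ k) r"
      using pcf r unfolding post_critically_finite_def by blast
    have "(f ^^ i) r \<in> (\<lambda>i. (f ^^ i) r) ` {..<j + k}" for i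
    proof (induction i rule: less_induct)
      case (less i)
      show ?case
      proof (cases "i < j + k")
        case False
        then obtain l where l: "i = l + (j + k)" using le_Suc_ex[of "j + k" i] by (auto simp: add.commute)
        have "(f ^^ i) r = (f ^^ (l + k)) r"
          unfolding l using jk(2) by (simp add: funpow_add)
        moreover have "l + k < i" using l jk(1) by simp
        ultimately show ?thesis using less.IH[of "l + k"] by (simp only:)
      qed auto
    qed
    then have "range (\<lambda>i. (f ^^ i) r) \<subseteq> (\<lambda>i. (f ^^ i) r) ` {..<j + k}" by blast
    then show ?thesis by (rule finite_subset) simp
  qed
  have "markov_partition f P"
  proof
    show "continuous_on {0..1} f" "f ` {0..1} \<subseteq> {0..1}" by (fact cont maps)+
    show "finite P" using crit_fin orbit_fin by (simp add: P_def)
    show "0 \<in> P" "1 \<in> P" using crit_P by (auto simp: critical_set_def)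
    have "(f ^^ i) r \<in> {0..1}" if "r \<in> critical_set f" for i r
      using continuous_on_funpow(2)[OF cont maps, of i] crit_sub that by blast
    then show "P \<subseteq> {0..1}" unfolding P_def by blast
    have "f ((f ^^ i) r) \<in> P" if "r \<in> critical_set f" for i r
      unfolding P_def using that by (intro UN_I[OF that] range_eqI[of _ _ "Suc i"]) simp
    then show "f ` P \<subseteq> P" unfolding P_def by blast
    fix a b :: real assume ab: "0 \<le> a" "a < b" "b \<le> 1" "{a<..<b} \<inter> P = {}"
    define k where "k = (LEAST k. a < c k)"
    have ex: "a < c (Suc m)" using ab c_ends by simp
    then have k: "a < c k" "k \<le> Suc m" unfolding k_def by (rule LeastI, rule Least_le)
    then obtain i where i: "k = Suc i" "i \<le> m" using ab c_ends by (cases k) auto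
    have "c i \<le> a" using not_less_Least[of i "\<lambda>k. a < c k"] i by (simp add: k_def[symmetric] not_less)
    have "c k \<in> critical_set f"
      using c_ends c_turn i by (cases "k = Suc m") (auto simp: critical_set_def)
    then have "b \<le> c k" using k ab(4) crit_P by (force simp: disjoint_iff)
    have "inj_on f {c i..c (Suc i)}"
      using c_mono[OF i(2)]
    proof
      assume "strict_mono_on {c i..c (Suc i)} f"
      then show ?thesis by (rule strict_mono_on_imp_inj_on)
    next
      assume "strict_antimono_on {c i..c (Suc i)} f"
      then show ?thesis by (simp add: strict_antimono_iff_antimono)
    qed
    then show "inj_on f {a..b}"
      by (rule inj_on_subset) (use \<open>c i \<le> a\<close> \<open>b \<le> c k\<close> i in auto)
  qed
  then show thesis by (rule that)
qed

section \<open>Levels of the inverse limit\<close>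

text \<open>
  Change of orientation of a level, used to place the relevant end of a gap to the right of the base point.
\<close>

definition reflect :: "bool \<Rightarrow> real \<Rightarrow> real" where
  "reflect d t = (if d then 1 - t else t)"

lemma reflect_reflect [simp]: "reflect d (reflect d t) = t"
  by (simp add: reflect_def)

lemma reflect_in [simp]: "reflect d t \<in> {0..1} \<longleftrightarrow> t \<in> {0..1}"
  by (auto simp: reflect_def)

lemma reflect_eq_iff [simp]: "reflect d s = reflect d t \<longleftrightarrow> s = t"
  by (simp add: reflect_def)

lemma reflect_ends [simp]: "reflect d 0 = (if d then 1 else 0)" "reflect d 1 = (if d then 0 else 1)"
  by (simp_all add: reflect_def)

lemma reflect_cont: "continuous_on S (reflect d)"
  unfolding reflect_def by (cases d) (auto intro: continuous_intros)

lemma reflect_segment: "t \<in> closed_segment r s \<Longrightarrow> reflect d t \<in> closed_segment (reflect d r) (reflect d s)"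
  by (auto simp: reflect_def closed_segment_eq_real_ivl split: if_splits)

lemma inverse_limit_funpow:
  assumes "\<xi> \<in> inverse_limit f"
  shows "(f ^^ n) (\<xi> (i + n)) = \<xi> i"
proof (induction n)
  case (Suc n)
  have "\<forall>k\<ge>1. f (\<xi> k) = \<xi> (k - 1)"
    using assms by (simp add: inverse_limit_def)
  then have "f (\<xi> (Suc (i + n))) = \<xi> (i + n)"
    by (auto dest: spec[of _ "Suc (i + n)"])
  then show ?case using Suc by (simp add: funpow_swap1)
qed simp

lemma compact_inverse_limit:
  assumes cont: "continuous_on {0..1} f"
  shows "compact (inverse_limit f)"
proof -
  define C :: "(nat \<Rightarrow> real) set" where "C = (\<Pi>\<^sub>E i\<in>UNIV. {0..1})"
  have "compact C"
    using compactin_PiE[of "\<lambda>_. euclidean :: real topology" UNIV "\<lambda>_ :: nat. {0..1}"]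
    by (simp add: C_def euclidean_product_topology)
  define E where "E i = {\<xi> \<in> C. f (\<xi> (Suc i)) - \<xi> i \<in> {0}}" for i
  have coord: "continuous_on C (\<lambda>\<xi>. \<xi> i)" for i :: nat
    by (rule continuous_on_subset[OF continuous_on_product_coordinates subset_UNIV])
  have "closed (E i)" for i
  proof -
    have "continuous_on C (\<lambda>\<xi>. f (\<xi> (Suc i)) - \<xi> i)"
      by (intro continuous_intros coord continuous_on_compose2[OF cont coord]) (auto simp: C_def PiE_def)
    then have "closed (C \<inter> (\<lambda>\<xi>. f (\<xi> (Suc i)) - \<xi> i) -` {0})"
      by (rule continuous_closed_preimage[OF _ compact_imp_closed[OF \<open>compact C\<close>] closed_singleton])
    moreover have "E i = C \<inter> (\<lambda>\<xi>. f (\<xi> (Suc i)) - \<xi> i) -` {0}"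
      by (auto simp: E_def)
    ultimately show ?thesis by simp
  qed
  moreover have "inverse_limit f = C \<inter> (\<Inter>i. E i)"
    by (auto simp: inverse_limit_def C_def E_def PiE_def Pi_def extensional_def Suc_le_eq gr0_conv_Suc)
  ultimately show ?thesis
    using \<open>compact C\<close> by (simp add: compact_Int_closed closed_INT)
qed

context markov_partition
begin

text \<open>
  Every point of a gap misses one of the two outer thirds, so the points where the iterate takes the values 0
  and 1 can be found strictly on one side of it. A third rather than a half keeps them away from the point
  even when it is the midpoint.
\<close>

lemma far_third:
  assumes ab: "gap a b" and z: "z \<in> {a..b}"
    and onto: "(f ^^ n) ` {a..a + (b - a) / 3} = {0..1}" "(f ^^ n) ` {b - (b - a) / 3..b} = {0..1}"
  shows "\<exists>d p\<^sub>0 p\<^sub>1. p\<^sub>0 \<in> {a..b} \<and> p\<^sub>1 \<in> {a..b} \<and> (f ^^ n) p\<^sub>0 = 0 \<and> (f ^^ n) p\<^sub>1 = 1 \<and>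
    reflect d z < reflect d p\<^sub>0 \<and> reflect d z < reflect d p\<^sub>1"
proof -
  define d where "d \<longleftrightarrow> b - z < z - a"
  define T where "T = (if d then {a..a + (b - a) / 3} else {b - (b - a) / 3..b})"
  have "(f ^^ n) ` T = {0..1}" using onto by (simp add: T_def)
  then have "0 \<in> (f ^^ n) ` T" "1 \<in> (f ^^ n) ` T" by simp_all
  then obtain p\<^sub>0 p\<^sub>1 where p: "p\<^sub>0 \<in> T" "p\<^sub>1 \<in> T" "(f ^^ n) p\<^sub>0 = 0" "(f ^^ n) p\<^sub>1 = 1"
    by (metis imageE)
  have "t \<in> {a..b} \<and> reflect d z < reflect d t" if "t \<in> T" for t
    using that z gap_in[OF ab] by (auto simp: T_def d_def reflect_def field_simps split: if_splits)
  then show ?thesis using p by blast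
qed

text \<open>
  The levels are the coordinates \<open>n * N\<close>. Each base point lies in a gap onto which a branch at
  the next base point is carried injectively, and the level is oriented so that the two points found in the
  gap lie above the base point. These points serve as \<open>w\<^sub>0\<close> and \<open>w\<^sub>1\<close>;
  as points of the gap they are reached along the branch at the next base point. The sweep of the next level
  starts at a point with value in \<open>P\<close>, and no interior point of the branch has such a value.
\<close>

lemma spread_system_exists:
  assumes leo: "locally_eventually_onto f" and x: "x \<in> inverse_limit f"
  shows "\<exists>\<zeta> \<phi> w\<^sub>0 w\<^sub>1 c y. spread_system (inverse_limit f) \<zeta> \<phi> x w\<^sub>0 w\<^sub>1 c y"
proof -
  obtain N where N: "1 \<le> N"
    and thirds: "\<And>a b. gap a b \<Longrightarrow> (f ^^ N) ` {a..a + (b - a) / 3} = {0..1}"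
      "\<And>a b. gap a b \<Longrightarrow> (f ^^ N) ` {b - (b - a) / 3..b} = {0..1}"
    by (rule outer_thirds_onto[OF leo]) (rule that)
  define F where "F = f ^^ N"
  have F_cont: "continuous_on {0..1} F" and F_maps: "F ` {0..1} \<subseteq> {0..1}"
    unfolding F_def by (rule iterate_cont, rule iterate_maps)
  have F_in: "F t \<in> {0..1}" if "t \<in> {0..1}" for t using F_maps that by blast
  have coord_in: "\<xi> i \<in> {0..1}" if "\<xi> \<in> inverse_limit f" for \<xi> i
    using that by (simp add: inverse_limit_def)
  have F_coord: "F (\<xi> (Suc n * N)) = \<xi> (n * N)" if "\<xi> \<in> inverse_limit f" for \<xi> n
    using inverse_limit_funpow[OF that, of N "n * N"] by (simp add: F_def add.commute)
  define z where "z n = x (n * N)" for n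
  have z_in: "z n \<in> {0..1}" and F_z: "F (z (Suc n)) = z n" for n
    using coord_in[OF x] F_coord[OF x] by (auto simp only: z_def)
  define branch where "branch n u v a b \<longleftrightarrow> z (Suc n) \<in> {u..v} \<and> {u..v} \<subseteq> {0..1} \<and>
      inj_on F {u..v} \<and> F ` {u..v} = {a..b} \<and> gap a b" for n u v a b
  have "\<exists>u v a b. branch n u v a b" for n
  proof -
    obtain \<alpha> \<beta> where gap: "gap \<alpha> \<beta>" "z (Suc n) \<in> {\<alpha>..\<beta>}"
      by (rule gap_between[OF ends_in_P zero_less_one z_in])
    have sub: "{\<alpha>..\<beta>} \<subseteq> {0..1}" using gap_in[OF gap(1)] by auto
    obtain u v a b where "z (Suc n) \<in> {u..v}" "{u..v} \<subseteq> {\<alpha>..\<beta>}" "inj_on F {u..v}" "F ` {u..v} = {a..b}" "gap a b"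
      using branch_onto_gap[OF gap, of N] unfolding F_def by blast
    then have "branch n u v a b" using sub unfolding branch_def by blast
    then show ?thesis by blast
  qed
  then obtain u v a b where "\<And>n. branch n (u n) (v n) (a n) (b n)"
    by metis
  then have uv: "z (Suc n) \<in> {u n..v n}" "{u n..v n} \<subseteq> {0..1}" and inj: "inj_on F {u n..v n}"
    and onto: "F ` {u n..v n} = {a n..b n}" and gap: "gap (a n) (b n)" for n
    unfolding branch_def by blast+
  have z_gap: "z n \<in> {a n..b n}" for n
    using imageI[OF uv(1), of F n] unfolding onto F_z .
  define far where "far n d p\<^sub>0 p\<^sub>1 \<longleftrightarrow> p\<^sub>0 \<in> {a n..b n} \<and> p\<^sub>1 \<in> {a n..b n} \<and> F p\<^sub>0 = 0 \<and> F p\<^sub>1 = 1 \<and>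
      reflect d (z n) < reflect d p\<^sub>0 \<and> reflect d (z n) < reflect d p\<^sub>1" for n d p\<^sub>0 p\<^sub>1
  have "\<exists>d p\<^sub>0 p\<^sub>1. far n d p\<^sub>0 p\<^sub>1" for n
    unfolding far_def F_def by (rule far_third[OF gap z_gap thirds[OF gap]])
  then obtain d p\<^sub>0 p\<^sub>1 where "\<And>n. far n (d n) (p\<^sub>0 n) (p\<^sub>1 n)"
    by metis
  then have p_in: "p\<^sub>0 n \<in> {a n..b n}" "p\<^sub>1 n \<in> {a n..b n}"
    and F_p: "F (p\<^sub>0 n) = 0" "F (p\<^sub>1 n) = 1"
    and beyond: "reflect (d n) (z n) < reflect (d n) (p\<^sub>0 n)" "reflect (d n) (z n) < reflect (d n) (p\<^sub>1 n)" for n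
    unfolding far_def by blast+
  define \<zeta> where "\<zeta> n \<xi> = reflect (d n) (\<xi> (n * N))" for n and \<xi> :: "nat \<Rightarrow> real"
  define \<phi> where "\<phi> n t = reflect (d n) (F (reflect (d (Suc n)) t))" for n t
  define r where "r n = reflect (d (Suc n)) (p\<^sub>0 (Suc n))" for n
  define s where "s n = reflect (d (Suc n)) (p\<^sub>1 (Suc n))" for n
  define w\<^sub>0 where "w\<^sub>0 n = min (r n) (s n)" for n
  define w\<^sub>1 where "w\<^sub>1 n = max (r n) (s n)" for n
  define c where "c n = \<phi> n (w\<^sub>0 n)" for n
  have ab_in: "{a n..b n} \<subseteq> {0..1}" for n using gap_in[OF gap[of n]] by auto
  have \<phi>_rs: "\<phi> n (r n) = (if d n then 1 else 0)" "\<phi> n (s n) = (if d n then 0 else 1)" for n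
    by (simp_all add: \<phi>_def r_def s_def F_p)
  have w_cases: "w\<^sub>0 n = r n \<and> w\<^sub>1 n = s n \<or> w\<^sub>0 n = s n \<and> w\<^sub>1 n = r n" for n
    by (auto simp: w\<^sub>0_def w\<^sub>1_def min_def max_def)
  have c: "c n \<in> {0, 1}" "\<phi> n (w\<^sub>1 n) = 1 - c n" for n
    using w_cases[of n] \<phi>_rs[of n] unfolding c_def by (auto split: if_splits)
  have w_less: "w\<^sub>0 n < w\<^sub>1 n" for n
  proof -
    have "\<phi> n (w\<^sub>0 n) \<noteq> \<phi> n (w\<^sub>1 n)" using c[of n] unfolding c_def by auto
    then have "w\<^sub>0 n \<noteq> w\<^sub>1 n" by metis
    then show ?thesis by (auto simp: w\<^sub>0_def w\<^sub>1_def)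
  qed
  have \<zeta>_less: "\<zeta> (Suc n) x < w\<^sub>0 n" for n
    using beyond[of "Suc n"] by (simp add: \<zeta>_def w\<^sub>0_def r_def s_def z_def)
  have rs_in: "reflect (d (Suc n)) (w\<^sub>0 n) \<in> {a (Suc n)..b (Suc n)}" "reflect (d (Suc n)) (w\<^sub>1 n) \<in> {a (Suc n)..b (Suc n)}" for n
    using w_cases[of n] p_in[of "Suc n"] by (auto simp: r_def s_def)
  have w\<^sub>1_le: "w\<^sub>1 n \<le> 1" for n
    using rs_in(2)[of n] ab_in[of "Suc n"] by (metis atLeastAtMost_iff reflect_in subsetD)
  have "reflect (d (Suc n)) (w\<^sub>1 n) \<in> F ` {u (Suc n)..v (Suc n)}" for n
    unfolding onto by (rule rs_in(2))
  then have "\<forall>n. \<exists>y'. y' \<in> {u (Suc n)..v (Suc n)} \<and> F y' = reflect (d (Suc n)) (w\<^sub>1 n)"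
    unfolding image_iff by metis
  then obtain y' where "\<forall>n. y' n \<in> {u (Suc n)..v (Suc n)} \<and> F (y' n) = reflect (d (Suc n)) (w\<^sub>1 n)"
    by (rule choice[THEN exE])
  then have y': "y' n \<in> {u (Suc n)..v (Suc n)}" "F (y' n) = reflect (d (Suc n)) (w\<^sub>1 n)" for n
    by blast+
  define y where "y n = reflect (d (Suc (Suc n))) (y' n)" for n
  have \<phi>_y: "\<phi> (Suc n) (y n) = w\<^sub>1 n" for n
    by (simp add: \<phi>_def y_def y'(2))
  have seg_sub: "closed_segment (z (Suc (Suc n))) (y' n) \<subseteq> {u (Suc n)..v (Suc n)}" for n
    using uv(1)[of "Suc n"] y'(1)[of n] by (auto simp: closed_segment_eq_real_ivl split: if_splits)
  have F_seg: "F t \<in> closed_segment (z (Suc n)) (reflect (d (Suc n)) (w\<^sub>1 n))"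
    if "t \<in> closed_segment (z (Suc (Suc n))) (y' n)" for t n
  proof -
    have "F ` closed_segment (z (Suc (Suc n))) (y' n) = closed_segment (F (z (Suc (Suc n)))) (F (y' n))"
      by (rule continuous_injective_image_segment_1[OF continuous_on_subset[OF F_cont order_trans[OF seg_sub uv(2)]]
            inj_on_subset[OF inj seg_sub]])
    then show ?thesis using imageI[OF that, of F] unfolding F_z y'(2) by (simp only:)
  qed
  have y_seg: "reflect (d (Suc (Suc n))) t \<in> closed_segment (z (Suc (Suc n))) (y' n)"
    if "t \<in> closed_segment (\<zeta> (Suc (Suc n)) x) (y n)" for t n
    using reflect_segment[OF that, of "d (Suc (Suc n))"] by (simp add: \<zeta>_def y_def z_def)
  have y_above: "\<zeta> (Suc n) x \<le> \<phi> (Suc n) t" if "t \<in> closed_segment (\<zeta> (Suc (Suc n)) x) (y n)" for t n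
  proof -
    have "\<phi> (Suc n) t \<in> closed_segment (\<zeta> (Suc n) x) (w\<^sub>1 n)"
      using reflect_segment[OF F_seg[OF y_seg[OF that]], of "d (Suc n)"] by (simp add: \<phi>_def \<zeta>_def z_def)
    then show ?thesis using \<zeta>_less[of n] w_less[of n] by (simp add: closed_segment_eq_real_ivl)
  qed
  have y_le: "y n \<le> w\<^sub>0 (Suc n)" for n
  proof (rule ccontr)
    assume less: "\<not> y n \<le> w\<^sub>0 (Suc n)"
    define t where "t = reflect (d (Suc (Suc n))) (w\<^sub>0 (Suc n))"
    have "F t \<in> P"
      using w_cases[of "Suc n"] F_p[of "Suc (Suc n)"] ends_in_P by (auto simp: t_def r_def s_def)
    have "w\<^sub>0 (Suc n) \<in> closed_segment (\<zeta> (Suc (Suc n)) x) (y n)"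
      using less \<zeta>_less[of "Suc n"] by (simp add: closed_segment_eq_real_ivl)
    then have seg: "t \<in> closed_segment (z (Suc (Suc n))) (y' n)"
      unfolding t_def by (rule y_seg)
    have "reflect (d (Suc (Suc n))) t = w\<^sub>0 (Suc n)" by (simp add: t_def)
    moreover have "reflect (d (Suc (Suc n))) (z (Suc (Suc n))) \<noteq> w\<^sub>0 (Suc n)"
      using \<zeta>_less[of "Suc n"] by (simp add: \<zeta>_def z_def)
    moreover have "reflect (d (Suc (Suc n))) (y' n) \<noteq> w\<^sub>0 (Suc n)"
      using less by (simp add: y_def)
    ultimately have "t \<noteq> z (Suc (Suc n))" "t \<noteq> y' n" by metis+
    then have "u (Suc n) < t" "t < v (Suc n)"
      using seg uv(1)[of "Suc n"] y'(1)[of n] by (auto simp: closed_segment_eq_real_ivl split: if_splits)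
    then have "F t \<notin> P"
      unfolding F_def by (rule branch_interior_avoids[OF uv(2) inj[unfolded F_def] onto[unfolded F_def] gap])
    then show False using \<open>F t \<in> P\<close> by blast
  qed
  have "spread_system (inverse_limit f) \<zeta> \<phi> x w\<^sub>0 w\<^sub>1 c y"
  proof
    show "compact (inverse_limit f)" by (rule compact_inverse_limit[OF f_cont])
    show "x \<in> inverse_limit f" by (rule x)
    show "continuous_on (inverse_limit f) (\<zeta> n)" for n
      unfolding \<zeta>_def by (rule continuous_on_compose2[OF reflect_cont[of UNIV]
            continuous_on_subset[OF continuous_on_product_coordinates subset_UNIV]]) simp
    show "\<zeta> n \<xi> \<in> {0..1}" if "\<xi> \<in> inverse_limit f" for n \<xi>
      unfolding \<zeta>_def reflect_in by (rule coord_in[OF that])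
    show "continuous_on {0..1} (\<phi> n)" for n
      unfolding \<phi>_def
      by (rule continuous_on_compose2[OF reflect_cont[of UNIV] continuous_on_compose2[OF F_cont reflect_cont]])
         (auto simp del: atLeastAtMost_iff)
    show "\<phi> n ` {0..1} \<subseteq> {0..1}" for n
      unfolding \<phi>_def image_subset_iff reflect_in using F_in by (metis reflect_in)
    show "\<phi> n (\<zeta> (Suc n) \<xi>) = \<zeta> n \<xi>" if "\<xi> \<in> inverse_limit f" for n \<xi>
      using F_coord[OF that, of n] by (simp add: \<phi>_def \<zeta>_def)
    show "\<xi> = \<xi>'" if \<xi>: "\<xi> \<in> inverse_limit f" "\<xi>' \<in> inverse_limit f" and eq: "\<And>n. \<zeta> n \<xi> = \<zeta> n \<xi>'" for \<xi> \<xi>'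
    proof
      fix i
      have i: "i + (i * N - i) = i * N" using N by simp
      have "\<xi> (i * N) = \<xi>' (i * N)" using eq[of i] by (simp add: \<zeta>_def)
      then show "\<xi> i = \<xi>' i"
        using inverse_limit_funpow[OF \<xi>(1), of "i * N - i" i] inverse_limit_funpow[OF \<xi>(2), of "i * N - i" i]
        unfolding i by simp
    qed
    show "y n \<in> {0..1}" for n
      unfolding y_def reflect_in using y'(1)[of n] uv(2)[of "Suc n"] by blast
  qed (use \<zeta>_less w_less w\<^sub>1_le c c_def \<phi>_y y_above y_le in auto)
  then show ?thesis by blast
qed

end

theorem corollary5p8:
  fixes f :: "real \<Rightarrow> real" and x :: "nat \<Rightarrow> real"
  assumes "continuous_on {0..1} f"
    and "f ` {0..1} \<subseteq> {0..1}"
    and "piecewise_monotone f"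
    and "post_critically_finite f"
    and "locally_eventually_onto f"
    and "x \<in> inverse_limit f"
  shows "\<exists>\<nu>. thin_planar_embedding (inverse_limit f) \<nu> \<and>
             accessible_point (\<nu> ` inverse_limit f) (\<nu> x)"
proof -
  obtain P where "markov_partition f P"
    using post_critical_partition[OF assms(1-4)] by blast
  then interpret markov_partition f P .
  obtain \<zeta> \<phi> w\<^sub>0 w\<^sub>1 c y where "spread_system (inverse_limit f) \<zeta> \<phi> x w\<^sub>0 w\<^sub>1 c y"
    using spread_system_exists[OF assms(5,6)] by blast
  then show ?thesis by (rule spread_system.spread_system_embedding)
qed

end
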